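(* Let $n$ be a natural number and let $(X_p,\delta_p)_{p\in\mathbb{Z}}$ be a sequence of Banach spaces $X_p$ and operators $\delta_p\in L(X_p,X_{p-1})$ such that $X_p=0$ for $p<0$ and $p\ge n+1$, and $\delta_p=0$ for $p\le 0$ and $p>n$. Suppose that for every $p\in\mathbb{Z}$ the range $R(\delta_{p-1}\delta_p)$ is finite dimensional and $\delta_p$ is a regular operator. Let $\mathcal{X}_p=X_p/R(\delta_{p+1}\delta_{p+2})$ and let $\tilde\delta_p\in L(\mathcal{X}_p,\mathcal{X}_{p-1})$ be the operator induced by $\delta_p$. Let $\tilde\delta_p'\in L(\mathcal{X}_{p-1},\mathcal{X}_p)$, $p\in\mathbb{Z}$, be normalized generalized inverses of $\tilde\delta_p$ such that $\tilde\delta_{p+1}'\tilde\delta_p'=0$ for all $p\in\mathbb{Z}$, and let $\delta_p'\in L(X_{p-1},X_p)$ be the extension of $\tilde\delta_p'$ such that $\delta_p'=0$ on $R(\delta_p\delta_{p+1})$ (as described in the context). Then the following statements are equivalent: (i) $(X_p,\delta_p)_{p\in\mathbb{Z}}$ is a regular Fredholm chain. (ii) $\bigoplus_{p=2k}(\delta_p+\delta_{p+1}')\colon\bigoplus_{p=2k}X_p\to\bigoplus_{p=2k+1}X_p$ is a Fredholm operator. (iii) $\bigoplus_{p=2k+1}(\delta_p+\delta_{p+1}')\colon\bigoplus_{p=2k+1}X_p\to\bigoplus_{p=2k}X_p$ is a Fredholm operator. Furthermore, in this case, $$\operatorname{ind}(X_p,\delta_p)_{p\in\mathbb{Z}}=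\operatorname{ind}\bigoplus_{p=2k}(\delta_p+\delta_{p+1}')=-\operatorname{ind}\bigoplus_{p=2k+1}(\delta_p+\delta_{p+1}').$$
   Context: $L(X,Y)$ denotes the bounded linear operators from $X$ to $Y$; $N(\cdot)$ and $R(\cdot)$ denote null space and range. An operator $A\in L(X,Y)$ is regular if there is $B\in L(Y,X)$ with $A=ABA$; such a $B$ is a generalized inverse of $A$, and it is a normalized generalized inverse if in addition $B=BAB$. For a Fredholm operator $A$, $\operatorname{ind}(A)=\dim N(A)-\operatorname{codim}R(A)$. Fredholm chains: a sequence $(X_p,\delta_p)_{p\in\mathbb{Z}}$ of Banach spaces and operators $\delta_p\in L(X_p,X_{p-1})$, with $X_p=0$ for $p<0$ and $p\ge n+1$ and $\delta_p=0$ for $p\le 0$ and $p>n$ for some natural number $n$, is a Fredholm chain if $N(\delta_p)/(N(\delta_p)\cap R(\delta_{p+1}))$ and $R(\delta_{p+1})/(N(\delta_p)\cap R(\delta_{p+1}))$ are finite dimensional for all $p\in\mathbb{Z}$. Its index is $\operatorname{ind}(X_p,\delta_p)_{p\in\mathbb{Z}}=\sum_{p=0}^n(-1)^p d_p$, where $d_p=\dim N(\delta_p)/(N(\delta_p)\cap R(\delta_{p+1}))-\dim R(\delta_{p+1})/(N(\delta_p)\cap R(\delta_{p+1}))$. A Fredholm chain is regular if the operators $S=\bigoplus_{p=2k}\delta_p\colon\bigoplus_{p=2k}X_p\to\bigoplus_{p=2k+1}X_p$ and $T=\bigoplus_{p=2k+1}\delta_p\colon\bigoplus_{p=2k+1}X_p\to\bigoplus_{p=2k}X_p$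 are regular operators (equivalently, every $\delta_p$ is regular). The indices $p=2k$ and $p=2k+1$ mean that $p$ runs over all even, respectively odd, integers. The operator $\bigoplus_{p}(\delta_p+\delta_{p+1}')$ sends $(x_p)_p$ to $\sum_p(\delta_p x_p+\delta_{p+1}'x_p)$, where $\delta_p x_p\in X_{p-1}$ and $\delta_{p+1}'x_p\in X_{p+1}$. Induced operators: with $\pi_p\colon X_p\to\mathcal{X}_p$ the quotient map, $\tilde\delta_p$ is determined by $\tilde\delta_p\pi_p=\pi_{p-1}\delta_p$; one has $\tilde\delta_{p-1}\tilde\delta_p=0$. Under the stated hypotheses each $\tilde\delta_p$ is regular and normalized generalized inverses $\tilde\delta_p'$ with $\tilde\delta_{p+1}'\tilde\delta_p'=0$ exist. Extensions: fix for each $p$ a closed subspace $X_p^0\subseteq X_p$ with $X_p=R(\delta_{p+1}\delta_{p+2})\oplus X_p^0$. Then $\pi_p|_{X_p^0}\colon X_p^0\to\mathcal{X}_p$ is an isomorphism, by means of which $\tilde\delta_p'$ is viewed as an operator $X_{p-1}^0\to X_p^0$; $\delta_p'$ is its extension vanishing on $R(\delta_p\delta_{p+1})\subseteq X_{p-1}$, i.e. $\delta_p'=(\pi_p|_{X_p^0})^{-1}\tilde\delta_p'\pi_{p-1}$. *)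

theory Defs
  imports "HOL-Analysis.Analysis"
begin

section \<open>Normed spaces given by a carrier\<close>

text \<open>
  Three kinds of normed spaces occur: the given Banach spaces, their quotients (whose elements
  are cosets) and finite direct sums (whose elements are families).  As none of these can be a
  type here, a normed space is a record of a carrier with its operations and norm, over the
  scalar field \<open>'k\<close>.  Operators are functions of which only the values on the carrier
  matter.
\<close>

record ('k, 'v) nspace =
  vcarrier :: "'v set"
  vzero :: 'v
  vadd :: "'v \<Rightarrow> 'v \<Rightarrow> 'v"
  vscale :: "'k \<Rightarrow> 'v \<Rightarrow> 'v"
  vnorm :: "'v \<Rightarrow> real"

definition subsp :: "('k, 'v) nspace \<Rightarrow> 'v set \<Rightarrow> ('k, 'v) nspace" where
  "subsp V S = V\<lparr>vcarrier := S\<rparr>"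

definition vcoset :: "('k, 'v) nspace \<Rightarrow> 'v set \<Rightarrow> 'v \<Rightarrow> 'v set" where
  "vcoset V M x = vadd V x ` M"

definition quot :: "('k, 'v) nspace \<Rightarrow> 'v set \<Rightarrow> ('k, 'v set) nspace" where
  "quot V M =
    \<lparr>vcarrier = vcoset V M ` vcarrier V,
     vzero = M,
     vadd = (\<lambda>A B. {vadd V a b | a b. a \<in> A \<and> b \<in> B}),
     vscale = (\<lambda>c A. {vadd V (vscale V c a) m | a m. a \<in> A \<and> m \<in> M}),
     vnorm = (\<lambda>A. INF a\<in>A. vnorm V a)\<rparr>"

text \<open>
  The direct sum over \<open>p \<in> I\<close>, as families that vanish off \<open>I\<close>, with the
  \<open>\<ell>\<^sup>1\<close>-norm.  It is used only when all but finitely many summands are zero, so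
  that all customary norms are equivalent.
\<close>

definition direct_sum :: "int set \<Rightarrow> (int \<Rightarrow> ('k, 'v) nspace) \<Rightarrow> ('k, int \<Rightarrow> 'v) nspace" where
  "direct_sum I X =
    \<lparr>vcarrier = {x. (\<forall>p\<in>I. x p \<in> vcarrier (X p)) \<and> (\<forall>p. p \<notin> I \<longrightarrow> x p = vzero (X p))
                    \<and> finite {p. x p \<noteq> vzero (X p)}},
     vzero = (\<lambda>p. vzero (X p)),
     vadd = (\<lambda>x y p. vadd (X p) (x p) (y p)),
     vscale = (\<lambda>c x p. vscale (X p) c (x p)),
     vnorm = (\<lambda>x. \<Sum>p | x p \<noteq> vzero (X p). vnorm (X p) (x p))\<rparr>"


subsection \<open>Dimension\<close>

definition vcomb :: "('k, 'v) nspace \<Rightarrow> 'k list \<Rightarrow> 'v list \<Rightarrow> 'v" where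
  "vcomb V cs bs = foldr (vadd V) (map2 (vscale V) cs bs) (vzero V)"

definition vbasis :: "('k, 'v) nspace \<Rightarrow> 'v list \<Rightarrow> bool" where
  "vbasis V bs \<longleftrightarrow> set bs \<subseteq> vcarrier V \<and>
    (\<forall>x\<in>vcarrier V. \<exists>!cs. length cs = length bs \<and> x = vcomb V cs bs)"

definition fin_dim :: "('k, 'v) nspace \<Rightarrow> bool" where
  "fin_dim V \<longleftrightarrow> (\<exists>bs. vbasis V bs)"

definition vdim :: "('k, 'v) nspace \<Rightarrow> nat" where
  "vdim V = (THE m. \<exists>bs. vbasis V bs \<and> length bs = m)"


subsection \<open>Operators\<close>

definition bdd_op :: "('k, 'v) nspace \<Rightarrow> ('k, 'w) nspace \<Rightarrow> ('v \<Rightarrow> 'w) \<Rightarrow> bool" where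
  "bdd_op V W A \<longleftrightarrow>
    A ` vcarrier V \<subseteq> vcarrier W \<and>
    (\<forall>x\<in>vcarrier V. \<forall>y\<in>vcarrier V. A (vadd V x y) = vadd W (A x) (A y)) \<and>
    (\<forall>c. \<forall>x\<in>vcarrier V. A (vscale V c x) = vscale W c (A x)) \<and>
    (\<exists>K. \<forall>x\<in>vcarrier V. vnorm W (A x) \<le> K * vnorm V x)"

definition null_sp :: "('k, 'v) nspace \<Rightarrow> ('k, 'w) nspace \<Rightarrow> ('v \<Rightarrow> 'w) \<Rightarrow> 'v set" where
  "null_sp V W A = {x \<in> vcarrier V. A x = vzero W}"

definition range_sp :: "('k, 'v) nspace \<Rightarrow> ('v \<Rightarrow> 'w) \<Rightarrow> 'w set" where
  "range_sp V A = A ` vcarrier V"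

definition gen_inverse ::
  "('k, 'v) nspace \<Rightarrow> ('k, 'w) nspace \<Rightarrow> ('v \<Rightarrow> 'w) \<Rightarrow> ('w \<Rightarrow> 'v) \<Rightarrow> bool" where
  "gen_inverse V W A B \<longleftrightarrow> bdd_op W V B \<and> (\<forall>x\<in>vcarrier V. A (B (A x)) = A x)"

definition normalized_gen_inverse ::
  "('k, 'v) nspace \<Rightarrow> ('k, 'w) nspace \<Rightarrow> ('v \<Rightarrow> 'w) \<Rightarrow> ('w \<Rightarrow> 'v) \<Rightarrow> bool" where
  "normalized_gen_inverse V W A B \<longleftrightarrow>
    gen_inverse V W A B \<and> (\<forall>y\<in>vcarrier W. B (A (B y)) = B y)"

definition regular_op :: "('k, 'v) nspace \<Rightarrow> ('k, 'w) nspace \<Rightarrow> ('v \<Rightarrow> 'w) \<Rightarrow> bool" where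
  "regular_op V W A \<longleftrightarrow> bdd_op V W A \<and> (\<exists>B. gen_inverse V W A B)"

definition fredholm_op :: "('k, 'v) nspace \<Rightarrow> ('k, 'w) nspace \<Rightarrow> ('v \<Rightarrow> 'w) \<Rightarrow> bool" where
  "fredholm_op V W A \<longleftrightarrow>
    bdd_op V W A \<and> fin_dim (subsp V (null_sp V W A)) \<and> fin_dim (quot W (range_sp V A))"

definition fredholm_ind :: "('k, 'v) nspace \<Rightarrow> ('k, 'w) nspace \<Rightarrow> ('v \<Rightarrow> 'w) \<Rightarrow> int" where
  "fredholm_ind V W A =
    int (vdim (subsp V (null_sp V W A))) - int (vdim (quot W (range_sp V A)))"


section \<open>Banach spaces\<close>

text \<open>
  The sort of \<open>'k\<close> admits precisely the real and the complex scalars (up to isomorphism), so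
  that both kinds of Banach spaces are covered.  The map \<open>smul\<close> makes the type \<open>'a\<close>, which is
  already a real Banach space, into a Banach space over \<open>'k\<close>.
\<close>

locale banach_scaling = vector_space smul
  for smul :: "'k::{real_normed_field, heine_borel} \<Rightarrow> 'a::banach \<Rightarrow> 'a" +
  assumes norm_scale: "norm (smul c x) = norm c * norm x"
    and scale_of_real: "smul (of_real r) x = r *\<^sub>R x"

text \<open>
  The Banach spaces of a sequence are closed subspaces of one ambient Banach space.  Since only
  finitely many of them are nonzero this is no restriction: they all embed isometrically, as
  closed subspaces, into their \<open>\<ell>\<^sup>1\<close>-sum.
\<close>

definition banach_in ::
  "('k::{real_normed_field, heine_borel} \<Rightarrow> 'a::banach \<Rightarrow> 'a) \<Rightarrow> ('k, 'a) nspace \<Rightarrow> bool" where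
  "banach_in smul V \<longleftrightarrow>
    (\<exists>S. module.subspace smul S \<and> closed S \<and>
      V = \<lparr>vcarrier = S, vzero = 0, vadd = (+), vscale = smul, vnorm = norm\<rparr>)"


section \<open>Sequences of Banach spaces and Fredholm chains\<close>

definition banach_sequence ::
  "('k::{real_normed_field, heine_borel} \<Rightarrow> 'a::banach \<Rightarrow> 'a) \<Rightarrow> nat \<Rightarrow>
    (int \<Rightarrow> ('k, 'a) nspace) \<Rightarrow> (int \<Rightarrow> 'a \<Rightarrow> 'a) \<Rightarrow> bool" where
  "banach_sequence smul n X d \<longleftrightarrow>
    (\<forall>p. banach_in smul (X p)) \<and>
    (\<forall>p. bdd_op (X p) (X (p - 1)) (d p)) \<and>
    (\<forall>p. p < 0 \<or> p \<ge> int n + 1 \<longrightarrow> vcarrier (X p) = {0}) \<and>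
    (\<forall>p. p \<le> 0 \<or> p > int n \<longrightarrow> (\<forall>x\<in>vcarrier (X p). d p x = 0))"

definition chain_N :: "(int \<Rightarrow> ('k, 'a) nspace) \<Rightarrow> (int \<Rightarrow> 'a \<Rightarrow> 'a) \<Rightarrow> int \<Rightarrow> 'a set" where
  "chain_N X d p = null_sp (X p) (X (p - 1)) (d p)"

definition chain_R :: "(int \<Rightarrow> ('k, 'a) nspace) \<Rightarrow> (int \<Rightarrow> 'a \<Rightarrow> 'a) \<Rightarrow> int \<Rightarrow> 'a set" where
  "chain_R X d p = range_sp (X p) (d p)"

definition N_quot ::
  "(int \<Rightarrow> ('k, 'a) nspace) \<Rightarrow> (int \<Rightarrow> 'a \<Rightarrow> 'a) \<Rightarrow> int \<Rightarrow> ('k, 'a set) nspace" where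
  "N_quot X d p = quot (subsp (X p) (chain_N X d p)) (chain_N X d p \<inter> chain_R X d (p + 1))"

definition R_quot ::
  "(int \<Rightarrow> ('k, 'a) nspace) \<Rightarrow> (int \<Rightarrow> 'a \<Rightarrow> 'a) \<Rightarrow> int \<Rightarrow> ('k, 'a set) nspace" where
  "R_quot X d p =
    quot (subsp (X p) (chain_R X d (p + 1))) (chain_N X d p \<inter> chain_R X d (p + 1))"

definition fredholm_chain ::
  "('k::{real_normed_field, heine_borel} \<Rightarrow> 'a::banach \<Rightarrow> 'a) \<Rightarrow> nat \<Rightarrow>
    (int \<Rightarrow> ('k, 'a) nspace) \<Rightarrow> (int \<Rightarrow> 'a \<Rightarrow> 'a) \<Rightarrow> bool" where
  "fredholm_chain smul n X d \<longleftrightarrow>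
    banach_sequence smul n X d \<and> (\<forall>p. fin_dim (N_quot X d p) \<and> fin_dim (R_quot X d p))"

definition chain_ind ::
  "nat \<Rightarrow> (int \<Rightarrow> ('k, 'a) nspace) \<Rightarrow> (int \<Rightarrow> 'a \<Rightarrow> 'a) \<Rightarrow> int" where
  "chain_ind n X d =
    (\<Sum>p=0..n. (-1) ^ p * (int (vdim (N_quot X d (int p))) - int (vdim (R_quot X d (int p)))))"

abbreviation evens :: "int set" where "evens \<equiv> {p. even p}"
abbreviation odds :: "int set" where "odds \<equiv> {p. odd p}"

text \<open>
  The operators \<open>\<Oplus>\<^sub>p \<delta>\<^sub>p\<close> and \<open>\<Oplus>\<^sub>p (\<delta>\<^sub>p + \<delta>'\<^sub>p\<^sub>+\<^sub>1)\<close>, written by target components.  The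
  set \<open>J\<close> is the index set of the target sum; as \<open>\<delta>\<^sub>p\<close> lowers and
  \<open>\<delta>'\<^sub>p\<^sub>+\<^sub>1\<close> raises the index \<open>p\<close> by one, the component with index \<open>q \<in> J\<close>
  is \<open>\<delta>\<^sub>q\<^sub>+\<^sub>1 x\<^sub>q\<^sub>+\<^sub>1\<close>, respectively \<open>\<delta>\<^sub>q\<^sub>+\<^sub>1 x\<^sub>q\<^sub>+\<^sub>1 + \<delta>'\<^sub>q x\<^sub>q\<^sub>-\<^sub>1\<close>.
\<close>

definition sum_diff ::
  "int set \<Rightarrow> (int \<Rightarrow> ('k, 'a) nspace) \<Rightarrow> (int \<Rightarrow> 'a \<Rightarrow> 'a) \<Rightarrow> (int \<Rightarrow> 'a) \<Rightarrow> (int \<Rightarrow> 'a)" where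
  "sum_diff J X d x = (\<lambda>q. if q \<in> J then d (q + 1) (x (q + 1)) else vzero (X q))"

definition sum_total ::
  "int set \<Rightarrow> (int \<Rightarrow> ('k, 'a) nspace) \<Rightarrow> (int \<Rightarrow> 'a \<Rightarrow> 'a) \<Rightarrow> (int \<Rightarrow> 'a \<Rightarrow> 'a) \<Rightarrow>
    (int \<Rightarrow> 'a) \<Rightarrow> (int \<Rightarrow> 'a)" where
  "sum_total J X d d' x =
    (\<lambda>q. if q \<in> J then vadd (X q) (d (q + 1) (x (q + 1))) (d' q (x (q - 1))) else vzero (X q))"

definition regular_fredholm_chain ::
  "('k::{real_normed_field, heine_borel} \<Rightarrow> 'a::banach \<Rightarrow> 'a) \<Rightarrow> nat \<Rightarrow>
    (int \<Rightarrow> ('k, 'a) nspace) \<Rightarrow> (int \<Rightarrow> 'a \<Rightarrow> 'a) \<Rightarrow> bool" where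
  "regular_fredholm_chain smul n X d \<longleftrightarrow>
    fredholm_chain smul n X d \<and>
    regular_op (direct_sum evens X) (direct_sum odds X) (sum_diff odds X d) \<and>
    regular_op (direct_sum odds X) (direct_sum evens X) (sum_diff evens X d)"


section \<open>Induced operators and their extensions\<close>

text \<open>
  \<open>RR X d p\<close> is \<open>R(\<delta>\<^sub>p\<^sub>+\<^sub>1 \<delta>\<^sub>p\<^sub>+\<^sub>2)\<close>, by which \<open>X\<^sub>p\<close> is divided, and \<open>proj X d p\<close> is the
  quotient map \<open>\<pi>\<^sub>p\<close>.  In \<open>induced\<close> the image is a singleton because \<open>\<delta>\<^sub>p\<close> maps
  \<open>RR X d p\<close> into \<open>RR X d (p - 1)\<close>.  The operator \<open>extension\<close> is
  \<open>(\<pi>\<^sub>p|X0\<^sub>p)\<^sup>-\<^sup>1 dt'\<^sub>p \<pi>\<^sub>p\<^sub>-\<^sub>1\<close>; it vanishes on \<open>RR X d (p - 1)\<close>.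
\<close>

definition RR :: "(int \<Rightarrow> ('k, 'a) nspace) \<Rightarrow> (int \<Rightarrow> 'a \<Rightarrow> 'a) \<Rightarrow> int \<Rightarrow> 'a set" where
  "RR X d p = range_sp (X (p + 2)) (d (p + 1) \<circ> d (p + 2))"

definition calX ::
  "(int \<Rightarrow> ('k, 'a) nspace) \<Rightarrow> (int \<Rightarrow> 'a \<Rightarrow> 'a) \<Rightarrow> int \<Rightarrow> ('k, 'a set) nspace" where
  "calX X d p = quot (X p) (RR X d p)"

definition proj ::
  "(int \<Rightarrow> ('k, 'a) nspace) \<Rightarrow> (int \<Rightarrow> 'a \<Rightarrow> 'a) \<Rightarrow> int \<Rightarrow> 'a \<Rightarrow> 'a set" where
  "proj X d p = vcoset (X p) (RR X d p)"

definition induced ::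
  "(int \<Rightarrow> ('k, 'a) nspace) \<Rightarrow> (int \<Rightarrow> 'a \<Rightarrow> 'a) \<Rightarrow> int \<Rightarrow> 'a set \<Rightarrow> 'a set" where
  "induced X d p A = the_elem ((\<lambda>x. proj X d (p - 1) (d p x)) ` A)"

definition closed_complement ::
  "('k::{real_normed_field, heine_borel} \<Rightarrow> 'a::banach \<Rightarrow> 'a) \<Rightarrow> ('k, 'a) nspace \<Rightarrow>
    'a set \<Rightarrow> 'a set \<Rightarrow> bool" where
  "closed_complement smul V M C \<longleftrightarrow>
    module.subspace smul C \<and> closed C \<and> C \<subseteq> vcarrier V \<and>
    M \<inter> C = {0} \<and> vcarrier V = {m + c | m c. m \<in> M \<and> c \<in> C}"

definition extension ::
  "(int \<Rightarrow> ('k, 'a) nspace) \<Rightarrow> (int \<Rightarrow> 'a \<Rightarrow> 'a) \<Rightarrow> (int \<Rightarrow> 'a set) \<Rightarrow>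
    (int \<Rightarrow> 'a set \<Rightarrow> 'a set) \<Rightarrow> int \<Rightarrow> 'a \<Rightarrow> 'a" where
  "extension X d X0 dt' p y =
    the_inv_into (X0 p) (proj X d p) (dt' p (proj X d (p - 1) y))"

end

theory Submission
  imports Defs "HOL-Library.Function_Algebras"
begin

text \<open>
  Modulo the finite-dimensional spaces \<open>M\<^sub>p = R(\<delta>\<^sub>p\<^sub>+\<^sub>1 \<delta>\<^sub>p\<^sub>+\<^sub>2)\<close> both \<open>\<delta>\<close> and \<open>\<delta>'\<close> square to zero and
  are generalized inverses of each other, so \<open>\<delta> + \<delta>'\<close> splits: its kernel and a complement of its range
  are, modulo \<open>M\<close>, the sums of the spaces
  \<open>K\<^sub>p = {x \<in> X\<^sub>p. \<delta>\<^sub>p x \<in> M\<^sub>p\<^sub>-\<^sub>1, \<delta>'\<^sub>p\<^sub>+\<^sub>1 x = 0}\<close> over the even and over the odd \<open>p\<close>.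
  Both \<open>K\<^sub>p / M\<^sub>p\<close> and \<open>N(\<delta>\<^sub>p) / (N(\<delta>\<^sub>p) \<inter> R(\<delta>\<^sub>p\<^sub>+\<^sub>1))\<close> are isomorphic to
  \<open>(N(\<delta>\<^sub>p) + R(\<delta>\<^sub>p\<^sub>+\<^sub>1)) / R(\<delta>\<^sub>p\<^sub>+\<^sub>1)\<close>, while \<open>R(\<delta>\<^sub>p\<^sub>+\<^sub>1) / (N(\<delta>\<^sub>p) \<inter> R(\<delta>\<^sub>p\<^sub>+\<^sub>1))\<close> is isomorphic
  to \<open>M\<^sub>p\<^sub>-\<^sub>1\<close>.  Passing from the quotients by \<open>M\<close> back to \<open>X\<close> changes the index by the alternating sum of
  \<open>dim M\<^sub>p\<close>, which is precisely the contribution of the second family of quotients to the chain index.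
\<close>

section \<open>Relative dimension\<close>

locale linear_space = vector_space scale
  for scale :: "'a::field \<Rightarrow> 'b::ab_group_add \<Rightarrow> 'b"
begin

text \<open>Linear independence modulo the span of \<open>M\<close>, arranged so that an independent
  list can be extended at its head.\<close>

primrec indep_over :: "'b set \<Rightarrow> 'b list \<Rightarrow> bool" where
  "indep_over M [] = True"
| "indep_over M (b # bs) = (b \<notin> span (M \<union> set bs) \<and> indep_over M bs)"

text \<open>For subspaces \<open>M\<close> contained in \<open>S\<close> this is dim S/M. With
  values in \<open>enat\<close>, dimensions can be added and compared before anything is known to be
  finite.\<close>

definition reldim :: "'b set \<Rightarrow> 'b set \<Rightarrow> enat" where
  "reldim M S = (SUP bs\<in>{bs. set bs \<subseteq> S \<and> indep_over M bs}. enat (length bs))"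

text \<open>Steinitz exchange. Walking up from the tail, the first \<open>b\<close> that
  \<open>t\<close> makes dependent on \<open>M\<close> and the later vectors can be traded for
  \<open>t\<close> without changing the span; no other vector is lost.\<close>

lemma indep_over_exchange:
  assumes "indep_over M bs"
  shows "indep_over (insert t M) bs \<or>
    (\<exists>bs'. length bs = Suc (length bs') \<and> indep_over (insert t M) bs' \<and>
      span (insert t M \<union> set bs') = span (M \<union> set bs))"
  using assms
proof (induction bs)
  case (Cons b bs)
  then have b: "b \<notin> span (M \<union> set bs)" and ind: "indep_over M bs" by auto
  from Cons.IH[OF ind] show ?case
  proof (elim disjE exE conjE)
    assume i: "indep_over (insert t M) bs"
    show ?thesis
    proof (cases "b \<in> span (insert t (M \<union> set bs))")
      case True
      then have t: "t \<in> span (insert b (M \<union> set bs))"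
        using b in_span_insert by blast
      have "span (insert t (M \<union> set bs)) = span (insert b (M \<union> set bs))"
        using True t by (meson span_mono subset_insertI insert_subset span_eq span_superset subset_trans)
      then show ?thesis using i by (intro disjI2 exI[of _ bs]) simp
    next
      case False
      then show ?thesis using i by simp
    qed
  next
    fix bs' assume l: "length bs = Suc (length bs')" and i: "indep_over (insert t M) bs'"
      and s: "span (insert t M \<union> set bs') = span (M \<union> set bs)"
    have "span (insert b (insert t M \<union> set bs')) = span (insert b (M \<union> set bs))"
      using s by (simp only: span_insert)
    then show ?thesis using l i s b by (intro disjI2 exI[of _ "b # bs'"]) simp
  qed
qed simp

text \<open>The vectors of \<open>ts\<close> are moved into \<open>M\<close> one by one; by the
  exchange each of them costs \<open>bs\<close> at most one vector, and modulo a spanning set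
  nothing independent remains.\<close>

lemma indep_over_length_le:
  assumes "indep_over M bs" "set bs \<subseteq> span (M \<union> set ts)"
  shows "length bs \<le> length ts"
  using assms
proof (induction ts arbitrary: M bs)
  case Nil
  then show ?case
    using span_mono[of M "M \<union> set (tl bs)"] by (cases bs) auto
next
  case (Cons t ts)
  have eq: "insert t M \<union> set ts = M \<union> set (t # ts)" by auto
  from indep_over_exchange[OF Cons.prems(1), of t] show ?case
  proof (elim disjE exE conjE)
    assume "indep_over (insert t M) bs"
    from Cons.IH[OF this] Cons.prems(2) show ?thesis by (simp add: eq)
  next
    fix bs' assume l: "length bs = Suc (length bs')" and i: "indep_over (insert t M) bs'"
      and s: "span (insert t M \<union> set bs') = span (M \<union> set bs)"
    have "set bs' \<subseteq> span (M \<union> set bs)" using s span_superset by blast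
    also have "\<dots> \<subseteq> span (M \<union> set (t # ts))"
      using Cons.prems(2) by (intro span_minimal) (auto simp: span_base)
    finally have "length bs' \<le> length ts"
      by (intro Cons.IH[OF i]) (simp add: eq)
    then show ?thesis using l by simp
  qed
qed

text \<open>Since \<open>M\<close> and \<open>cs\<close> lie in \<open>N\<close>, a vector that is
  new modulo \<open>N\<close> is also new modulo \<open>M\<close> and \<open>cs\<close>. This glues
  bases in a tower of subspaces.\<close>

lemma indep_over_append:
  "indep_over N bs \<Longrightarrow> indep_over M cs \<Longrightarrow> M \<subseteq> N \<Longrightarrow> set cs \<subseteq> N \<Longrightarrow> indep_over M (bs @ cs)"
proof (induction bs)
  case (Cons b bs)
  have "span (M \<union> set (bs @ cs)) \<subseteq> span (N \<union> set bs)"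
    using Cons.prems(3,4) by (intro span_mono) auto
  moreover have "b \<notin> span (N \<union> set bs)" "indep_over N bs"
    using Cons.prems(1) by simp_all
  ultimately show ?case using Cons.IH[OF _ Cons.prems(2-4)] by (simp only: append_Cons indep_over.simps) blast
qed simp

lemma indep_over_antimono: "indep_over N bs \<Longrightarrow> M \<subseteq> N \<Longrightarrow> indep_over M bs"
  by (rule indep_over_append[of N bs M "[]", unfolded append_Nil2]) simp_all

lemma length_le_reldim: "indep_over M bs \<Longrightarrow> set bs \<subseteq> S \<Longrightarrow> enat (length bs) \<le> reldim M S"
  unfolding reldim_def by (rule SUP_upper[of bs _ "\<lambda>bs. enat (length bs)"]) blast

lemma reldim_le_length: "S \<subseteq> span (M \<union> set ts) \<Longrightarrow> reldim M S \<le> enat (length ts)"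
  unfolding reldim_def
proof (rule SUP_least)
  fix bs assume "S \<subseteq> span (M \<union> set ts)" "bs \<in> {bs. set bs \<subseteq> S \<and> indep_over M bs}"
  then have "length bs \<le> length ts" by (intro indep_over_length_le[of M]) auto
  then show "enat (length bs) \<le> enat (length ts)" by simp
qed

lemma reldim_eq_length:
  "indep_over M bs \<Longrightarrow> set bs \<subseteq> S \<Longrightarrow> S \<subseteq> span (M \<union> set bs) \<Longrightarrow> reldim M S = enat (length bs)"
  by (intro order_antisym length_le_reldim reldim_le_length)

lemma reldim_finite_obtain:
  assumes "reldim M S \<noteq> \<infinity>"
  obtains bs where "indep_over M bs" "set bs \<subseteq> S" "S \<subseteq> span (M \<union> set bs)"
    "reldim M S = enat (length bs)"
proof -
  obtain k where k: "reldim M S = enat k" using assms by auto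
  have "\<And>bs. set bs \<subseteq> S \<and> indep_over M bs \<Longrightarrow> length bs < Suc k"
    using length_le_reldim k by (metis enat_ord_simps(1) less_Suc_eq_le)
  \<comment> \<open>The lengths are bounded, so a longest independent list exists; it spans, for a
    vector outside its span could be put at its head.\<close>
  then obtain bs where bs: "set bs \<subseteq> S \<and> indep_over M bs"
    and mx: "\<And>cs. set cs \<subseteq> S \<and> indep_over M cs \<Longrightarrow> length cs \<le> length bs"
    using ex_has_greatest_nat[of "\<lambda>bs. set bs \<subseteq> S \<and> indep_over M bs" "[]" length "Suc k"]
    by auto
  have "S \<subseteq> span (M \<union> set bs)"
  proof
    fix x assume "x \<in> S"
    then show "x \<in> span (M \<union> set bs)"
      using mx[of "x # bs"] bs by auto
  qed
  then show thesis using that bs reldim_eq_length by blast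
qed

text \<open>Bases of the two steps concatenate to a basis of the whole. If one step is infinite, so
  is the whole, because \<open>reldim\<close> grows when \<open>S\<close> grows and when
  \<open>M\<close> shrinks.\<close>

lemma reldim_add:
  assumes "M \<subseteq> N" "N \<subseteq> S" "subspace N"
  shows "reldim M S = reldim M N + reldim N S"
proof (cases "reldim M N = \<infinity> \<or> reldim N S = \<infinity>")
  case True
  have "reldim M N \<le> reldim M S"
    unfolding reldim_def by (rule SUP_subset_mono) (use assms in auto)
  moreover have "reldim N S \<le> reldim M S"
    unfolding reldim_def
    by (rule SUP_subset_mono) (use assms indep_over_antimono in auto)
  ultimately show ?thesis using True by auto
next
  case False
  obtain bs where bs: "indep_over M bs" "set bs \<subseteq> N" "N \<subseteq> span (M \<union> set bs)"
    "reldim M N = enat (length bs)"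
    using False reldim_finite_obtain by blast
  obtain cs where cs: "indep_over N cs" "set cs \<subseteq> S" "S \<subseteq> span (N \<union> set cs)"
    "reldim N S = enat (length cs)"
    using False reldim_finite_obtain by blast
  have "span (N \<union> set cs) \<subseteq> span (M \<union> set (cs @ bs))"
  proof (rule span_minimal)
    have "N \<subseteq> span (M \<union> set (cs @ bs))"
      using bs(3) span_mono[of "M \<union> set bs" "M \<union> set (cs @ bs)"] by auto
    then show "N \<union> set cs \<subseteq> span (M \<union> set (cs @ bs))" by (auto simp: span_base)
  qed simp
  then have "reldim M S = enat (length (cs @ bs))"
    using bs cs assms by (intro reldim_eq_length indep_over_append) auto
  then show ?thesis using bs cs by simp
qed

section \<open>Coordinates modulo a subspace\<close>

definition lincomb :: "'a list \<Rightarrow> 'b list \<Rightarrow> 'b" where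
  "lincomb cs bs = foldr (+) (map2 scale cs bs) 0"

lemma lincomb_simps [simp]:
  "lincomb [] bs = 0" "lincomb cs [] = 0"
  "lincomb (c # cs) (b # bs) = scale c b + lincomb cs bs"
  by (simp_all add: lincomb_def)

lemma lincomb_zero: "lincomb (replicate k 0) bs = 0"
proof (induction k arbitrary: bs)
  case (Suc k)
  then show ?case by (cases bs) simp_all
qed simp

lemma lincomb_in_span: "lincomb cs bs \<in> span (set bs)"
proof (induction bs arbitrary: cs)
  case (Cons b bs)
  show ?case
  proof (cases cs)
    case (Cons c cs')
    have "lincomb cs' bs \<in> span (insert b (set bs))"
      using Cons.IH span_mono[of "set bs" "insert b (set bs)"] by auto
    moreover have "scale c b \<in> span (insert b (set bs))" by (intro span_scale span_base) simp
    ultimately show ?thesis using Cons by (simp add: span_add)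
  qed (simp add: span_zero)
qed simp

lemma lincomb_of_span:
  assumes "subspace M" "x \<in> span (M \<union> set bs)"
  shows "\<exists>cs. length cs = length bs \<and> x - lincomb cs bs \<in> M"
  using assms(2)
proof (induction bs arbitrary: x)
  case Nil
  then show ?case using assms(1) by (simp add: span_eq_iff[THEN iffD2])
next
  case (Cons b bs)
  then obtain k where "x - scale k b \<in> span (M \<union> set bs)"
    by (auto simp: span_breakdown_eq)
  from Cons.IH[OF this] obtain cs where "length cs = length bs"
    "x - scale k b - lincomb cs bs \<in> M" by auto
  then show ?case by (intro exI[of _ "k # cs"]) (simp add: algebra_simps)
qed

text \<open>Only the head coefficient matters: if two coordinate lists differ there,
  \<open>b\<close> can be solved for modulo \<open>M\<close> in terms of the later vectors.\<close>

lemma indep_over_iff_unique: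
  assumes "subspace M"
  shows "indep_over M bs \<longleftrightarrow>
    (\<forall>cs cs'. length cs = length bs \<and> length cs' = length bs \<and>
       lincomb cs bs - lincomb cs' bs \<in> M \<longrightarrow> cs = cs')"
    (is "_ \<longleftrightarrow> ?U bs")
proof (induction bs)
  case (Cons b bs)
  show ?case
  proof
    assume i: "indep_over M (b # bs)"
    show "?U (b # bs)"
    proof (intro allI impI, elim conjE)
      fix es es' assume "length es = length (b # bs)" "length es' = length (b # bs)"
        and m: "lincomb es (b # bs) - lincomb es' (b # bs) \<in> M"
      then obtain c cs c' cs' where e: "es = c # cs" "es' = c' # cs'"
        "length cs = length bs" "length cs' = length bs" by (auto simp: length_Suc_conv)
      let ?z = "lincomb cs bs - lincomb cs' bs"
      have m': "scale (c - c') b + ?z \<in> M" using m e by (simp add: algebra_simps)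
      have "c = c'"
      proof (rule ccontr)
        assume "c \<noteq> c'"
        have "?z \<in> span (M \<union> set bs)"
          using span_mono[of "set bs" "M \<union> set bs"] lincomb_in_span by (blast intro: span_diff)
        moreover have "scale (c - c') b + ?z \<in> span (M \<union> set bs)" using m' by (auto intro: span_base)
        ultimately have "scale (c - c') b \<in> span (M \<union> set bs)" using span_add_eq2 by blast
        then have "b \<in> span (M \<union> set bs)"
          using \<open>c \<noteq> c'\<close> span_scale[of "scale (c - c') b" _ "inverse (c - c')"] by simp
        then show False using i by simp
      qed
      then show "es = es'" using e m' i Cons.IH by auto
    qed
  next
    assume u: "?U (b # bs)"
    have "?U bs"
    proof (intro allI impI, elim conjE)
      fix cs cs' assume "length cs = length bs" "length cs' = length bs" "lincomb cs bs - lincomb cs' bs \<in> M"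
      then show "cs = cs'" using u[rule_format, of "0 # cs" "0 # cs'"] by simp
    qed
    moreover have "b \<notin> span (M \<union> set bs)"
    proof
      assume "b \<in> span (M \<union> set bs)"
      from lincomb_of_span[OF assms this] obtain cs where "length cs = length bs" "b - lincomb cs bs \<in> M"
        by auto
      \<comment> \<open>A dependent \<open>b\<close> would have two coordinate lists modulo
        \<open>M\<close>: the unit list and \<open>0 # cs\<close>.\<close>
      then show False
        using u[rule_format, of "1 # replicate (length bs) 0" "0 # cs"] by (simp add: lincomb_zero)
    qed
    ultimately show "indep_over M (b # bs)" using Cons.IH by simp
  qed
qed (simp)

text \<open>Turns the unique coordinates demanded by \<open>vbasis\<close> into independence and
  spanning. It serves quotients with a general \<open>M\<close> and subspaces with \<open>M\<close>
  equal to \<open>{0}\<close>.\<close>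

lemma coordinates_iff:
  assumes "subspace M" "subspace S" "M \<subseteq> S" "set bs \<subseteq> S"
  shows "(\<forall>x\<in>S. \<exists>!cs. length cs = length bs \<and> x - lincomb cs bs \<in> M) \<longleftrightarrow>
    indep_over M bs \<and> S \<subseteq> span (M \<union> set bs)" (is "?L \<longleftrightarrow> ?R")
proof
  assume L: ?L
  have "S \<subseteq> span (M \<union> set bs)"
  proof
    fix x assume "x \<in> S"
    then obtain cs where "x - lincomb cs bs \<in> M" using L by blast
    then have "x - lincomb cs bs + lincomb cs bs \<in> span (M \<union> set bs)"
      using span_mono[of "set bs" "M \<union> set bs"] lincomb_in_span
      by (intro span_add) (auto intro: span_base)
    then show "x \<in> span (M \<union> set bs)" by simp
  qed
  moreover have "indep_over M bs"
    unfolding indep_over_iff_unique[OF assms(1)]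
  proof (intro allI impI, elim conjE)
    fix cs cs' assume l: "length cs = length bs" "length cs' = length bs"
      and "lincomb cs bs - lincomb cs' bs \<in> M"
    moreover have "lincomb cs bs \<in> S"
      using lincomb_in_span assms span_minimal by blast
    moreover have "lincomb cs bs - lincomb cs bs \<in> M" using assms(1) subspace_0 by simp
    ultimately show "cs = cs'" using L by blast
  qed
  ultimately show ?R by simp
next
  assume R: ?R
  show ?L
  proof
    fix x assume "x \<in> S"
    then obtain cs where cs: "length cs = length bs" "x - lincomb cs bs \<in> M"
      using R lincomb_of_span[OF assms(1)] by blast
    show "\<exists>!cs. length cs = length bs \<and> x - lincomb cs bs \<in> M"
    proof (rule ex1I[of _ cs])
      fix cs' assume c': "length cs' = length bs \<and> x - lincomb cs' bs \<in> M"
      then have "(x - lincomb cs bs) - (x - lincomb cs' bs) \<in> M"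
        using cs assms(1) subspace_diff by blast
      then have "lincomb cs' bs - lincomb cs bs \<in> M" by simp
      then show "cs' = cs" using R indep_over_iff_unique[OF assms(1)] cs c' by blast
    qed (use cs in simp)
  qed
qed

section \<open>Cosets, quotients and dimension of spaces given by records\<close>

text \<open>The norm is left open, so that the purely algebraic dimension theory applies equally to
  the spaces \<open>X p\<close>, their subspaces and the direct sums.\<close>

definition carries :: "('a, 'b) nspace \<Rightarrow> 'b set \<Rightarrow> bool" where
  "carries V S \<longleftrightarrow> vcarrier V = S \<and> vzero V = 0 \<and> vadd V = (+) \<and> vscale V = scale"

lemma carriesD:
  assumes "carries V S"
  shows "vcarrier V = S" "vzero V = 0" "vadd V = (+)" "vscale V = scale"
  using assms unfolding carries_def by simp_all

lemma carries_subsp: "carries V S \<Longrightarrow> carries (subsp V T) T"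
  by (simp add: carries_def subsp_def)

lemma mem_vcoset_iff:
  assumes "carries V S"
  shows "a \<in> vcoset V M x \<longleftrightarrow> a - x \<in> M"
  unfolding vcoset_def carriesD(3)[OF assms] image_iff
  by (metis add_diff_cancel_left' diff_add_cancel add.commute)

lemma vcoset_eq_iff:
  assumes "carries V S" "subspace M"
  shows "vcoset V M x = vcoset V M y \<longleftrightarrow> x - y \<in> M"
proof
  assume "vcoset V M x = vcoset V M y"
  moreover have "x \<in> vcoset V M x"
    using assms(2) subspace_0 by (simp add: mem_vcoset_iff[OF assms(1)])
  ultimately show "x - y \<in> M" by (simp add: mem_vcoset_iff[OF assms(1)])
next
  assume m: "x - y \<in> M"
  have "a - x \<in> M \<longleftrightarrow> a - y \<in> M" for a
    using subspace_add[OF assms(2) _ m, of "a - x"] subspace_diff[OF assms(2) _ m, of "a - y"]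
    by auto
  then show "vcoset V M x = vcoset V M y" by (auto simp: mem_vcoset_iff[OF assms(1)])
qed

lemma vcoset_add:
  assumes "carries V S" "subspace M"
  shows "vadd (quot V M) (vcoset V M x) (vcoset V M y) = vcoset V M (x + y)"
proof (rule set_eqI)
  fix a
  have "(\<exists>u v. a = u + v \<and> u - x \<in> M \<and> v - y \<in> M) \<longleftrightarrow> a - (x + y) \<in> M"
  proof
    assume "\<exists>u v. a = u + v \<and> u - x \<in> M \<and> v - y \<in> M"
    then obtain u v where "a = u + v" "u - x \<in> M" "v - y \<in> M" by blast
    then show "a - (x + y) \<in> M"
      using subspace_add[OF assms(2), of "u - x" "v - y"] by (simp add: algebra_simps)
  next
    assume "a - (x + y) \<in> M"
    then show "\<exists>u v. a = u + v \<and> u - x \<in> M \<and> v - y \<in> M"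
      using subspace_0[OF assms(2)]
      by (intro exI[of _ x] exI[of _ "a - x"]) (simp add: algebra_simps)
  qed
  then show "a \<in> vadd (quot V M) (vcoset V M x) (vcoset V M y) \<longleftrightarrow> a \<in> vcoset V M (x + y)"
    by (simp add: quot_def mem_vcoset_iff[OF assms(1)] carriesD[OF assms(1)])
qed

lemma vcoset_scale:
  assumes "carries V S" "subspace M"
  shows "vscale (quot V M) c (vcoset V M x) = vcoset V M (scale c x)"
proof (rule set_eqI)
  fix a
  have "(\<exists>u v. a = scale c u + v \<and> u - x \<in> M \<and> v \<in> M) \<longleftrightarrow> a - scale c x \<in> M"
  proof
    assume "\<exists>u v. a = scale c u + v \<and> u - x \<in> M \<and> v \<in> M"
    then obtain u v where "a = scale c u + v" "u - x \<in> M" "v \<in> M" by blast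
    then show "a - scale c x \<in> M"
      using subspace_add[OF assms(2) subspace_scale[OF assms(2), of "u - x" c], of v]
      by (simp add: algebra_simps)
  next
    assume "a - scale c x \<in> M"
    then show "\<exists>u v. a = scale c u + v \<and> u - x \<in> M \<and> v \<in> M"
      using subspace_0[OF assms(2)]
      by (intro exI[of _ x] exI[of _ "a - scale c x"]) simp
  qed
  then show "a \<in> vscale (quot V M) c (vcoset V M x) \<longleftrightarrow> a \<in> vcoset V M (scale c x)"
    by (simp add: quot_def mem_vcoset_iff[OF assms(1)] carriesD[OF assms(1)])
qed

lemma vzero_quot: "carries V S \<Longrightarrow> vzero (quot V M) = vcoset V M 0"
  by (simp add: quot_def vcoset_def carriesD)

lemma vcarrier_quot: "carries V S \<Longrightarrow> vcarrier (quot V M) = vcoset V M ` S"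
  by (simp add: quot_def carriesD)

lemma vcomb_quot:
  assumes "carries V S" "subspace M"
  shows "vcomb (quot V M) cs (map (vcoset V M) bs) = vcoset V M (lincomb cs bs)"
proof (induction cs arbitrary: bs)
  case Nil
  then show ?case using assms by (simp add: vcomb_def vzero_quot)
next
  case (Cons c cs)
  then show ?case using assms
    by (cases bs) (simp_all add: vcomb_def vzero_quot vcoset_add vcoset_scale)
qed

lemma vbasis_quot_iff:
  assumes V: "carries V S" and M: "subspace M" and S: "subspace S" "M \<subseteq> S" "set bs \<subseteq> S"
  shows "vbasis (quot V M) (map (vcoset V M) bs) \<longleftrightarrow> indep_over M bs \<and> S \<subseteq> span (M \<union> set bs)"
proof -
  have "vbasis (quot V M) (map (vcoset V M) bs) \<longleftrightarrow>
      (\<forall>x\<in>S. \<exists>!cs. length cs = length bs \<and> x - lincomb cs bs \<in> M)"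
    using S(3)
    by (simp add: vbasis_def vcomb_quot[OF V M] vcoset_eq_iff[OF V M] vcarrier_quot[OF V] image_mono)
  then show ?thesis using coordinates_iff[OF M S] by simp
qed

lemma vbasis_subsp_iff:
  assumes V: "carries V S" and T: "subspace T" "set bs \<subseteq> T"
  shows "vbasis (subsp V T) bs \<longleftrightarrow> indep_over {0} bs \<and> T \<subseteq> span ({0} \<union> set bs)"
proof -
  have "vbasis (subsp V T) bs \<longleftrightarrow>
      (\<forall>x\<in>T. \<exists>!cs. length cs = length bs \<and> x - lincomb cs bs \<in> {0})"
    using T(2)
    by (simp add: vbasis_def vcomb_def lincomb_def subsp_def carriesD[OF V])
  then show ?thesis using coordinates_iff[of "{0}" T bs] T subspace_0 by simp
qed

text \<open>Representatives of the cosets form a basis modulo \<open>M\<close>. Hence all bases of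
  the quotient have the same length, which makes the description operator in \<open>vdim\<close>
  well-defined.\<close>

lemma vbasis_quot_imp:
  assumes V: "carries V S" and M: "subspace M" and S: "subspace S" "M \<subseteq> S"
    and B: "vbasis (quot V M) Bs"
  shows "reldim M S = enat (length Bs)"
proof -
  have "set Bs \<subseteq> vcoset V M ` S"
    using B by (simp add: vbasis_def vcarrier_quot[OF V])
  then have "Bs \<in> map (vcoset V M) ` lists S" by (auto simp: lists_image[symmetric])
  then obtain bs where bs: "Bs = map (vcoset V M) bs" "set bs \<subseteq> S" by auto
  then show ?thesis using B vbasis_quot_iff[OF V M S bs(2)] reldim_eq_length by simp
qed

lemma fin_dim_quot_iff:
  assumes V: "carries V S" and M: "subspace M" and S: "subspace S" "M \<subseteq> S"
  shows "fin_dim (quot V M) \<longleftrightarrow> reldim M S \<noteq> \<infinity>"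
  by (metis V M S reldim_finite_obtain fin_dim_def vbasis_quot_iff vbasis_quot_imp enat.distinct(1))

lemma reldim_quot:
  assumes V: "carries V S" and M: "subspace M" and S: "subspace S" "M \<subseteq> S"
    and "fin_dim (quot V M)"
  shows "reldim M S = enat (vdim (quot V M))"
proof -
  obtain Bs where Bs: "vbasis (quot V M) Bs" using assms(5) fin_dim_def by blast
  have "vdim (quot V M) = length Bs" unfolding vdim_def
    by (rule the_equality, use Bs in blast) (metis vbasis_quot_imp[OF V M S] Bs enat.inject)
  then show ?thesis using vbasis_quot_imp[OF V M S Bs] by simp
qed

lemma vbasis_subsp_imp:
  assumes V: "carries V S" and T: "subspace T" and B: "vbasis (subsp V T) bs"
  shows "reldim {0} T = enat (length bs)"
proof -
  have "set bs \<subseteq> T" using B by (simp add: vbasis_def subsp_def)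
  then show ?thesis using B vbasis_subsp_iff[OF V T] by (intro reldim_eq_length) auto
qed

lemma fin_dim_subsp_iff:
  assumes V: "carries V S" and T: "subspace T"
  shows "fin_dim (subsp V T) \<longleftrightarrow> reldim {0} T \<noteq> \<infinity>"
  by (metis V T reldim_finite_obtain fin_dim_def vbasis_subsp_iff vbasis_subsp_imp enat.distinct(1))

lemma reldim_subsp:
  assumes V: "carries V S" and T: "subspace T" and "fin_dim (subsp V T)"
  shows "reldim {0} T = enat (vdim (subsp V T))"
proof -
  obtain bs where bs: "vbasis (subsp V T) bs" using assms(3) fin_dim_def by blast
  have "vdim (subsp V T) = length bs" unfolding vdim_def
    by (rule the_equality, use bs in blast) (metis vbasis_subsp_imp[OF V T] bs enat.inject)
  then show ?thesis using vbasis_subsp_imp[OF V T bs] by simp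
qed

end

section \<open>Linear maps and relative dimension\<close>

locale linear_space_pair = V: linear_space s1 + W: linear_space s2
  for s1 :: "'a::field \<Rightarrow> 'b::ab_group_add \<Rightarrow> 'b"
    and s2 :: "'a \<Rightarrow> 'c::ab_group_add \<Rightarrow> 'c"
begin

text \<open>Linearity is asked for on a set only, since nothing is known about an operator off its
  carrier.\<close>

definition linear_on :: "'b set \<Rightarrow> ('b \<Rightarrow> 'c) \<Rightarrow> bool" where
  "linear_on S f \<longleftrightarrow>
    (\<forall>x\<in>S. \<forall>y\<in>S. f (x + y) = f x + f y) \<and> (\<forall>c. \<forall>x\<in>S. f (s1 c x) = s2 c (f x))"

lemma linear_on_add: "linear_on S f \<Longrightarrow> x \<in> S \<Longrightarrow> y \<in> S \<Longrightarrow> f (x + y) = f x + f y"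
  and linear_on_scale: "linear_on S f \<Longrightarrow> x \<in> S \<Longrightarrow> f (s1 c x) = s2 c (f x)"
  by (auto simp: linear_on_def)

lemma linear_on_subset: "linear_on S f \<Longrightarrow> T \<subseteq> S \<Longrightarrow> linear_on T f"
  unfolding linear_on_def by blast

lemma linear_on_0:
  assumes "linear_on S f" "V.subspace S"
  shows "f 0 = 0"
  using linear_on_scale[OF assms(1) V.subspace_0[OF assms(2)], of 0] by simp

lemma linear_on_diff:
  assumes "linear_on S f" "V.subspace S" "x \<in> S" "y \<in> S"
  shows "f (x - y) = f x - f y"
  using linear_on_add[OF assms(1) V.subspace_diff[OF assms(2-4)] assms(4)] by simp

lemma subspace_linear_image:
  assumes "linear_on S f" "V.subspace S"
  shows "W.subspace (f ` S)"
proof (rule W.subspaceI)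
  show "0 \<in> f ` S" using linear_on_0[OF assms] V.subspace_0[OF assms(2)] by force
  show "x + y \<in> f ` S" if "x \<in> f ` S" "y \<in> f ` S" for x y
    using that linear_on_add[OF assms(1)] V.subspace_add[OF assms(2)] by (auto simp: image_iff) metis
  show "s2 c x \<in> f ` S" if "x \<in> f ` S" for c x
    using that linear_on_scale[OF assms(1)] V.subspace_scale[OF assms(2)] by (auto simp: image_iff) metis
qed

lemma subspace_linear_vimage:
  assumes "linear_on S f" "V.subspace S" "W.subspace M"
  shows "V.subspace {x \<in> S. f x \<in> M}"
proof (rule V.subspaceI)
  show "0 \<in> {x \<in> S. f x \<in> M}"
    using linear_on_0[OF assms(1,2)] V.subspace_0[OF assms(2)] W.subspace_0[OF assms(3)] by simp
  show "x + y \<in> {x \<in> S. f x \<in> M}" if "x \<in> {x \<in> S. f x \<in> M}" "y \<in> {x \<in> S. f x \<in> M}" for x y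
    using that V.subspace_add[OF assms(2)] W.subspace_add[OF assms(3)]
    by (simp add: linear_on_add[OF assms(1)])
  show "s1 c x \<in> {x \<in> S. f x \<in> M}" if "x \<in> {x \<in> S. f x \<in> M}" for c x
    using that V.subspace_scale[OF assms(2)] W.subspace_scale[OF assms(3)]
    by (simp add: linear_on_scale[OF assms(1)])
qed

lemma span_Un_linear_image:
  assumes f: "linear_on S f" and S: "V.subspace S" and M: "W.subspace M" and B: "B \<subseteq> S"
    and z: "z \<in> W.span (M \<union> f ` B)"
  shows "\<exists>x\<in>V.span B. z - f x \<in> M"
proof -
  have BS: "V.span B \<subseteq> S" using B S V.span_minimal by blast
  have lin: "linear_on (V.span B) f" using linear_on_subset[OF f BS] .
  \<comment> \<open>The vectors that agree modulo \<open>M\<close> with the image of something in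
    the span of \<open>B\<close> form a subspace, and it contains \<open>M\<close> and the image of
    \<open>B\<close>.\<close>
  have "W.span (M \<union> f ` B) \<subseteq> {z. \<exists>x\<in>V.span B. z - f x \<in> M}"
  proof (rule W.span_minimal)
    show "M \<union> f ` B \<subseteq> {z. \<exists>x\<in>V.span B. z - f x \<in> M}"
      using V.span_zero[of B] linear_on_0[OF f S] W.subspace_0[OF M] V.span_base by force
    show "W.subspace {z. \<exists>x\<in>V.span B. z - f x \<in> M}"
    proof (rule W.subspaceI)
      show "0 \<in> {z. \<exists>x\<in>V.span B. z - f x \<in> M}"
        using V.span_zero[of B] linear_on_0[OF f S] W.subspace_0[OF M] by force
      show "y + z \<in> {z. \<exists>x\<in>V.span B. z - f x \<in> M}"
        if yz: "y \<in> {z. \<exists>x\<in>V.span B. z - f x \<in> M}" "z \<in> {z. \<exists>x\<in>V.span B. z - f x \<in> M}" for y z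
      proof -
        obtain a b where ab: "a \<in> V.span B" "b \<in> V.span B" "y - f a \<in> M" "z - f b \<in> M"
          using yz by blast
        then have "(y - f a) + (z - f b) \<in> M" using M W.subspace_add by blast
        then have "y + z - f (a + b) \<in> M"
          using ab by (simp add: linear_on_add[OF lin] algebra_simps)
        then show ?thesis using ab V.span_add by blast
      qed
      show "s2 c y \<in> {z. \<exists>x\<in>V.span B. z - f x \<in> M}"
        if y: "y \<in> {z. \<exists>x\<in>V.span B. z - f x \<in> M}" for c y
      proof -
        obtain a where a: "a \<in> V.span B" "y - f a \<in> M" using y by blast
        then have "s2 c (y - f a) \<in> M" using M W.subspace_scale by blast
        then have "s2 c y - f (s1 c a) \<in> M"
          using a by (simp add: linear_on_scale[OF lin] W.scale_right_diff_distrib)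
        then show ?thesis using a V.span_scale by blast
      qed
    qed
  qed
  then show ?thesis using z by blast
qed

lemma linear_image_span:
  assumes f: "linear_on S f" and S: "V.subspace S" and B: "B \<subseteq> S"
  shows "f ` V.span B \<subseteq> W.span (f ` B)"
proof -
  have "V.span B \<subseteq> {x \<in> S. f x \<in> W.span (f ` B)}"
    using B by (intro V.span_minimal subspace_linear_vimage[OF f S]) (auto intro: W.span_base)
  then show ?thesis by blast
qed

text \<open>A dependence of the images modulo \<open>M\<close> pulls back to a dependence modulo the
  preimage of \<open>M\<close>.\<close>

lemma indep_over_map:
  assumes f: "linear_on S f" and S: "V.subspace S" and M: "W.subspace M"
  shows "set bs \<subseteq> S \<Longrightarrow> V.indep_over {x \<in> S. f x \<in> M} bs \<Longrightarrow> W.indep_over M (map f bs)"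
proof (induction bs)
  case (Cons b bs)
  let ?N = "{x \<in> S. f x \<in> M}"
  have "f b \<notin> W.span (M \<union> f ` set bs)"
  proof
    assume "f b \<in> W.span (M \<union> f ` set bs)"
    then obtain x where x: "x \<in> V.span (set bs)" "f b - f x \<in> M"
      using span_Un_linear_image[OF f S M, of "set bs"] Cons.prems by auto
    have "x \<in> S" using x V.span_minimal[OF _ S] Cons.prems by auto
    then have "b - x \<in> ?N"
      using x Cons.prems(1) V.subspace_diff[OF S] by (simp add: linear_on_diff[OF f S])
    then have "b - x \<in> V.span (?N \<union> set bs)" by (simp add: V.span_base)
    moreover have "x \<in> V.span (?N \<union> set bs)" using x V.span_mono[of "set bs" "?N \<union> set bs"] by blast
    ultimately have "b \<in> V.span (?N \<union> set bs)" using V.span_add by fastforce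
    then show False using Cons.prems(2) by simp
  qed
  then show ?case using Cons by simp
qed simp

text \<open>The isomorphism theorem without forming quotients: \<open>f\<close> induces an injection
  of S/M into S'/M' that is onto by the last condition on \<open>S'\<close>. Independent lists and
  spanning lists are both pushed forward by \<open>f\<close>.\<close>

lemma reldim_iso:
  assumes f: "linear_on S f" and S: "V.subspace S" and M': "W.subspace M'"
    and S': "f ` S \<subseteq> S'" "\<And>y. y \<in> S' \<Longrightarrow> \<exists>x\<in>S. y - f x \<in> M'"
    and M: "M = {x \<in> S. f x \<in> M'}"
  shows "V.reldim M S = W.reldim M' S'"
proof (rule order_antisym)
  show "V.reldim M S \<le> W.reldim M' S'"
    unfolding V.reldim_def
  proof (rule SUP_least)
    fix bs assume bs: "bs \<in> {bs. set bs \<subseteq> S \<and> V.indep_over M bs}"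
    then have "W.indep_over M' (map f bs)" using indep_over_map[OF f S M'] M by simp
    then show "enat (length bs) \<le> W.reldim M' S'"
      using W.length_le_reldim[of M' "map f bs" S'] bs S' by auto
  qed
  show "W.reldim M' S' \<le> V.reldim M S"
  proof (cases "V.reldim M S = \<infinity>")
    case False
    obtain bs where bs: "set bs \<subseteq> S" "S \<subseteq> V.span (M \<union> set bs)" "V.reldim M S = enat (length bs)"
      by (rule V.reldim_finite_obtain[OF False]) iprover
    have "S' \<subseteq> W.span (M' \<union> set (map f bs))"
    proof
      fix y assume "y \<in> S'"
      then obtain x where x: "x \<in> S" "y - f x \<in> M'" using S' by blast
      have "f x \<in> W.span (f ` (M \<union> set bs))"
        using linear_image_span[OF f S, of "M \<union> set bs"] x bs M by blast
      also have "\<dots> \<subseteq> W.span (M' \<union> set (map f bs))" by (rule W.span_mono) (use M in auto)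
      finally have "(y - f x) + f x \<in> W.span (M' \<union> set (map f bs))"
        using x by (intro W.span_add) (auto intro: W.span_base)
      then show "y \<in> W.span (M' \<union> set (map f bs))" by simp
    qed
    then show ?thesis using W.reldim_le_length bs by (metis length_map)
  qed simp
qed

end

context linear_space
begin

text \<open>The second isomorphism theorem, with \<open>S'\<close> in the place of S + M'.\<close>

lemma reldim_inclusion:
  assumes "subspace S" "subspace M'" "S \<subseteq> S'" "\<And>y. y \<in> S' \<Longrightarrow> \<exists>x\<in>S. y - x \<in> M'"
  shows "reldim (S \<inter> M') S = reldim M' S'"
proof -
  interpret P: linear_space_pair scale scale ..
  show ?thesis
    by (rule P.reldim_iso[of S "\<lambda>x. x"]) (use assms in \<open>auto simp: P.linear_on_def\<close>)
qed

end

context linear_space_pair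
begin

text \<open>The numbers \<open>r\<close> and \<open>q\<close> are the dimensions of \<open>N \<inter> T V\<close> and \<open>N / (N \<inter> T V)\<close>.\<close>

lemma snake_dimensions:
  assumes T: "linear_on V T" "T ` V \<subseteq> W" "T ` M \<subseteq> N"
    and sub: "V.subspace V" "W.subspace W" "V.subspace M" "W.subspace N" "M \<subseteq> V" "N \<subseteq> W"
  obtains r q where
    "V.reldim {0} {x \<in> V. T x = 0} + r = V.reldim {0} M + V.reldim M {x \<in> V. T x \<in> N}"
    "W.reldim {0} N = r + q"
    "W.reldim (T ` V) W = q + W.reldim {t + m | t m. t \<in> T ` V \<and> m \<in> N} W"
proof
  let ?K = "{x \<in> V. T x = 0}" and ?P = "{x \<in> V. T x \<in> N}"
    and ?Z = "{t + m | t m. t \<in> T ` V \<and> m \<in> N}"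
  let ?r = "W.reldim {0} (N \<inter> T ` V)" and ?q = "W.reldim (N \<inter> T ` V) N"
  have K: "V.subspace ?K"
    using subspace_linear_vimage[OF T(1) sub(1) W.subspace_single_0] by simp
  have P: "V.subspace ?P" using subspace_linear_vimage[OF T(1) sub(1) sub(4)] .
  have TV: "W.subspace (T ` V)" by (rule subspace_linear_image[OF T(1) sub(1)])
  have T0: "0 \<in> M" "0 \<in> N" "0 \<in> T ` V" "T 0 = 0" "0 \<in> V"
    using sub TV linear_on_0[OF T(1) sub(1)] V.subspace_0 W.subspace_0 by auto
  \<comment> \<open>\<open>T\<close> maps \<open>?P\<close> onto the intersection of
    \<open>N\<close> with the range, with kernel \<open>?K\<close>. Computing the dimension of
    \<open>?P\<close> once through \<open>?K\<close> and once through \<open>M\<close> yields the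
    first identity.\<close>
  have "V.reldim ?K ?P = ?r"
    by (rule reldim_iso[of _ T])
      (use T linear_on_subset[OF T(1)] P T0 in \<open>auto\<close>)
  moreover have "V.reldim {0} ?P = V.reldim {0} ?K + V.reldim ?K ?P"
    using K T0 by (intro V.reldim_add) auto
  moreover have "V.reldim {0} ?P = V.reldim {0} M + V.reldim M ?P"
    using sub T T0 by (intro V.reldim_add) auto
  ultimately show "V.reldim {0} ?K + ?r = V.reldim {0} M + V.reldim M ?P" by simp
  show "W.reldim {0} N = ?r + ?q"
    using sub TV T0 by (intro W.reldim_add W.subspace_inter) auto
  have Z: "W.subspace ?Z"
    using W.subspace_sums[OF TV sub(4)] by (simp add: set_eq_iff) 
  have "N \<subseteq> ?Z"
  proof
    fix m assume "m \<in> N"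
    then show "m \<in> ?Z" using T0(3) by (intro CollectI exI[of _ 0] exI[of _ m]) simp
  qed
  moreover have "\<exists>x\<in>N. y - x \<in> T ` V" if "y \<in> ?Z" for y
    using that by (auto intro!: bexI)
  \<comment> \<open>\<open>N\<close> modulo its intersection with the range is the sum of the range
    and \<open>N\<close>, modulo the range.\<close>
  ultimately have "?q = W.reldim (T ` V) ?Z"
    by (intro W.reldim_inclusion sub TV)
  moreover have "W.reldim (T ` V) W = W.reldim (T ` V) ?Z + W.reldim ?Z W"
  proof (rule W.reldim_add[OF _ _ Z])
    show "T ` V \<subseteq> ?Z"
    proof
      fix t assume "t \<in> T ` V"
      then show "t \<in> ?Z" using T0(2) by (intro CollectI exI[of _ t] exI[of _ 0]) simp
    qed
    show "?Z \<subseteq> W"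
    proof
      fix z assume "z \<in> ?Z"
      then obtain t m where "z = t + m" "t \<in> W" "m \<in> W" using T(2) sub(6) by blast
      then show "z \<in> W" using W.subspace_add[OF sub(2)] by simp
    qed
  qed
  ultimately show "W.reldim (T ` V) W = ?q + W.reldim ?Z W" by simp
qed

end

section \<open>Families of vectors indexed by integers\<close>

text \<open>Finite support is not demanded: in the applications below all but finitely many of the
  spaces \<open>B p\<close> are \<open>{0}\<close>.\<close>

definition families :: "int set \<Rightarrow> (int \<Rightarrow> 'a::zero set) \<Rightarrow> (int \<Rightarrow> 'a) set" where
  "families I B = {x. \<forall>p. x p \<in> (if p \<in> I then B p else {0})}"

lemma mem_families_iff: "x \<in> families I B \<longleftrightarrow> (\<forall>p\<in>I. x p \<in> B p) \<and> (\<forall>p. p \<notin> I \<longrightarrow> x p = 0)"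
  by (auto simp: families_def)

lemma families_mono: "(\<And>p. A p \<subseteq> B p) \<Longrightarrow> families I A \<subseteq> families I B"
  unfolding mem_families_iff subset_iff by blast

locale family_space = linear_space scale
  for scale :: "'a::field \<Rightarrow> 'b::ab_group_add \<Rightarrow> 'b"
begin

abbreviation pscale :: "'a \<Rightarrow> (int \<Rightarrow> 'b) \<Rightarrow> int \<Rightarrow> 'b" where
  "pscale c x \<equiv> (\<lambda>p. scale c (x p))"

lemma linear_space_pscale: "linear_space pscale"
  by unfold_locales (auto simp: fun_eq_iff scale_right_distrib scale_left_distrib)

end

sublocale family_space \<subseteq> F: linear_space pscale
  by (rule linear_space_pscale)

context family_space
begin

lemma subspace_families:
  assumes "\<And>p. subspace (B p)"
  shows "F.subspace (families I B)"
  by (rule F.subspaceI)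
    (auto simp: mem_families_iff subspace_0[OF assms] subspace_add[OF assms] subspace_scale[OF assms])

text \<open>Passing from \<open>A\<close> to \<open>B\<close> one index at a time, the change at
  \<open>j\<close> contributes dim B(j)/A(j), as the \<open>j\<close>-th component shows.\<close>

lemma reldim_families:
  assumes "finite J" "J \<subseteq> I" "\<And>p. subspace (A p)" "\<And>p. subspace (B p)" "\<And>p. A p \<subseteq> B p"
    and "\<And>p. p \<in> I - J \<Longrightarrow> A p = B p"
  shows "F.reldim (families I A) (families I B) = (\<Sum>p\<in>J. reldim (A p) (B p))"
  using assms
proof (induction J arbitrary: A)
  case empty
  then have "families I A = families I B" by (auto simp: mem_families_iff)
  moreover have "F.reldim (families I B) (families I B) \<le> enat (length ([] :: (int \<Rightarrow> 'b) list))"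
    by (rule F.reldim_le_length) (auto intro: F.span_base)
  ultimately show ?case by (simp add: zero_enat_def[symmetric])
next
  case (insert j J)
  interpret P: linear_space_pair pscale scale ..
  let ?A = "A(j := B j)"
  have sub: "subspace (?A p)" for p using insert.prems(2,3) by simp
  have j: "j \<in> I" using insert.prems(1) by simp
  have "F.reldim (families I ?A) (families I B) = (\<Sum>p\<in>J. reldim (?A p) (B p))"
    using insert.prems by (intro insert.IH) auto
  also have "\<dots> = (\<Sum>p\<in>J. reldim (A p) (B p))"
    using insert.hyps by (intro sum.cong) auto
  finally have 1: "F.reldim (families I ?A) (families I B) = (\<Sum>p\<in>J. reldim (A p) (B p))" .
  have 2: "F.reldim (families I A) (families I ?A) = reldim (A j) (B j)"
  proof (rule P.reldim_iso[of _ "\<lambda>x. x j"])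
    show "P.linear_on (families I ?A) (\<lambda>x. x j)" by (simp add: P.linear_on_def)
    show "F.subspace (families I ?A)" using sub by (rule subspace_families)
    show "subspace (A j)" by (rule insert.prems(2))
    show "(\<lambda>x. x j) ` families I ?A \<subseteq> B j"
    proof
      fix y assume "y \<in> (\<lambda>x. x j) ` families I ?A"
      then obtain x where x: "x \<in> families I ?A" "y = x j" by (rule imageE)
      have "x j \<in> ?A j" using bspec[OF conjunct1[OF x(1)[unfolded mem_families_iff]] j] .
      then show "y \<in> B j" using x(2) by simp
    qed
    show "\<exists>x\<in>families I ?A. y - x j \<in> A j" if "y \<in> B j" for y
      using that j subspace_0[OF sub] subspace_0[OF insert.prems(2)]
      by (intro bexI[of _ "\<lambda>p. if p = j then y else 0"]) (auto simp: mem_families_iff)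
    show "families I A = {x \<in> families I ?A. x j \<in> A j}"
    proof (rule set_eqI)
      fix x
      have "x p \<in> A p \<longleftrightarrow> x p \<in> ?A p \<and> (p = j \<longrightarrow> x j \<in> A j)" for p
        using insert.prems(4)[of j] by auto
      then show "x \<in> families I A \<longleftrightarrow> x \<in> {x \<in> families I ?A. x j \<in> A j}"
        unfolding mem_families_iff mem_Collect_eq using j by metis
    qed
  qed
  have "A p \<subseteq> ?A p" "?A p \<subseteq> B p" for p using insert.prems(4)[of p] by auto
  from families_mono[OF this(1)] families_mono[OF this(2)] have "families I A \<subseteq> families I ?A" "families I ?A \<subseteq> families I B" .
  then have "F.reldim (families I A) (families I B) =
      F.reldim (families I A) (families I ?A) + F.reldim (families I ?A) (families I B)"
    using subspace_families[OF sub] by (rule F.reldim_add)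
  then show ?case using 1 2 insert.hyps by simp
qed

end

section \<open>Finite-dimensional complements\<close>

context banach_scaling
begin

text \<open>After factoring out a nonzero \<open>k\<close>, what remains is the distance from
  \<open>b\<close> to a point of \<open>C\<close>.\<close>

lemma norm_add_scale_ge_infdist:
  assumes "subspace C" "x \<in> C"
  shows "norm k * infdist b C \<le> norm (x + smul k b)"
proof (cases "k = 0")
  case False
  let ?y = "smul (- inverse k) x"
  have "x + smul k b = smul k (b - ?y)"
    using False by (simp add: scale_right_diff_distrib scale_right_distrib)
  then have "norm (x + smul k b) = norm k * dist b ?y" by (simp add: norm_scale dist_norm)
  moreover have "infdist b C \<le> dist b ?y"
    using assms subspace_scale by (intro infdist_le) blast
  ultimately show ?thesis by (simp add: mult_left_mono)
qed simp

text \<open>As \<open>b\<close> has positive distance \<open>D\<close> from \<open>C\<close>, the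
  norm of x + kb controls \<open>k\<close>. Hence in a convergent sequence of such sums the
  coefficients are Cauchy and converge, the scalars being complete, and the parts in
  \<open>C\<close> converge as well.\<close>

lemma
  assumes C: "subspace C" "closed C" and b: "b \<notin> C"
  shows closed_add_line: "closed {x + smul k b | x k. x \<in> C}" (is "closed ?L")
    and norm_le_add_line: "\<exists>K\<ge>0. \<forall>x\<in>C. \<forall>k. norm x \<le> K * norm (x + smul k b)"
proof -
  define D where "D = infdist b C"
  have "C \<noteq> {}" using subspace_0[OF C(1)] by blast
  then have D: "D > 0"
    unfolding D_def using C(2) b by (metis in_closed_iff_infdist_zero infdist_nonneg order_less_le)
  have le: "norm k * D \<le> norm (x + smul k b)" if "x \<in> C" for x k
    unfolding D_def using C(1) that by (rule norm_add_scale_ge_infdist)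
  show "closed ?L"
    unfolding closed_sequential_limits
  proof (intro allI impI, elim conjE)
    fix z l assume "\<forall>n. z n \<in> ?L" and zl: "z \<longlonglongrightarrow> l"
    then have "\<forall>n. \<exists>x k. z n = x + smul k b \<and> x \<in> C" by blast
    then obtain x k where z: "\<And>n. z n = x n + smul (k n) b" and x: "\<And>n. x n \<in> C" by metis
    have "Cauchy k"
    proof (rule metric_CauchyI)
      fix e :: real assume "e > 0"
      then have "e * D > 0" using D by simp
      then obtain N where N: "\<forall>m\<ge>N. \<forall>n\<ge>N. dist (z m) (z n) < e * D"
        using LIMSEQ_imp_Cauchy[OF zl] metric_CauchyD by blast
      have "dist (k m) (k n) < e" if "m \<ge> N" "n \<ge> N" for m n
      proof -
        have "norm (k m - k n) * D \<le> norm ((x m - x n) + smul (k m - k n) b)"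
          using x subspace_diff[OF C(1)] by (intro le) blast
        also have "(x m - x n) + smul (k m - k n) b = z m - z n"
          by (simp add: z scale_left_diff_distrib)
        also have "norm (z m - z n) < e * D" using N that by (simp add: dist_norm)
        finally show ?thesis using D by (simp add: dist_norm)
      qed
      then show "\<exists>N. \<forall>m\<ge>N. \<forall>n\<ge>N. dist (k m) (k n) < e" by blast
    qed
    then obtain k0 where k0: "k \<longlonglongrightarrow> k0" using Cauchy_convergent convergent_def by blast
    have "(\<lambda>n. smul (k n) b) \<longlonglongrightarrow> smul k0 b"
    proof (rule Lim_transform_bound[where g = "\<lambda>n. norm (k n - k0) * norm b", THEN Lim_null[THEN iffD2], OF _ _])
      show "\<forall>\<^sub>F n in sequentially. norm (smul (k n) b - smul k0 b) \<le> norm (norm (k n - k0) * norm b)"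
        by (simp add: norm_scale scale_left_diff_distrib[symmetric])
      show "(\<lambda>n. norm (k n - k0) * norm b) \<longlonglongrightarrow> 0"
        using tendsto_mult_left_zero[OF tendsto_norm_zero[OF LIM_zero[OF k0]]] .
    qed
    then have "(\<lambda>n. z n - smul (k n) b) \<longlonglongrightarrow> l - smul k0 b" by (intro tendsto_diff zl)
    then have "x \<longlonglongrightarrow> l - smul k0 b" by (simp add: z)
    then have "l - smul k0 b \<in> C" using C(2) x closed_sequential_limits by blast
    then have "l = (l - smul k0 b) + smul k0 b \<and> l - smul k0 b \<in> C" by simp
    then show "l \<in> ?L" by blast
  qed
  \<comment> \<open>The triangle inequality leaves the term |k| norm(b), and |k| is at most norm(x +
    kb)/D.\<close>
  have "norm x \<le> (1 + norm b / D) * norm (x + smul k b)" if "x \<in> C" for x k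
  proof -
    have "norm x \<le> norm (x + smul k b) + norm k * norm b"
      using norm_triangle_ineq4[of "x + smul k b" "smul k b"] by (simp add: norm_scale)
    also have "norm k * norm b \<le> norm (x + smul k b) / D * norm b"
      using le[OF that] D by (intro mult_right_mono) (auto simp: field_simps)
    finally show ?thesis by (simp add: algebra_simps)
  qed
  then show "\<exists>K\<ge>0. \<forall>x\<in>C. \<forall>k. norm x \<le> K * norm (x + smul k b)"
    using D by (intro exI[of _ "1 + norm b / D"]) auto
qed

text \<open>The projection onto \<open>C\<close> along a finite-dimensional complement is bounded.
  In the induction a new vector \<open>b\<close> is removed from the span and its line is added to
  \<open>C\<close>; the enlarged space is still closed and still meets the smaller span only in
  0.\<close>

lemma norm_le_norm_add_span:
  assumes "subspace C" "closed C" "span (set bs) \<inter> C = {0}"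
  shows "\<exists>K\<ge>0. \<forall>m\<in>span (set bs). \<forall>c\<in>C. norm c \<le> K * norm (m + c)"
  using assms
proof (induction bs arbitrary: C)
  case Nil
  then show ?case by (intro exI[of _ 1]) simp
next
  case (Cons b bs)
  show ?case
  proof (cases "b \<in> span (set bs)")
    case True
    then have "span (set (b # bs)) = span (set bs)" by (simp add: span_redundant)
    then show ?thesis using Cons.IH[OF Cons.prems(1,2)] Cons.prems(3) by (simp only:)
  next
    case False
    have b: "b \<in> span (set (b # bs))" by (simp add: span_base)
    have "b \<notin> C"
    proof
      assume "b \<in> C"
      with b have "b = 0" using Cons.prems(3) by auto
      then show False using False span_zero by simp
    qed
    note line = closed_add_line[OF Cons.prems(1,2) this] norm_le_add_line[OF Cons.prems(1,2) this]
    let ?L = "{x + smul k b | x k. x \<in> C}"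
    have L: "subspace ?L"
    proof -
      have "?L = {x + y | x y. x \<in> C \<and> y \<in> span {b}}" unfolding span_singleton by blast
      then show ?thesis using subspace_sums[OF Cons.prems(1) subspace_span[of "{b}"]] by simp
    qed
    have "span (set bs) \<inter> ?L \<subseteq> {0}"
    proof
      fix v assume v: "v \<in> span (set bs) \<inter> ?L"
      then obtain x k where x: "v = x + smul k b" "x \<in> C" by blast
      have "v \<in> span (set (b # bs))" using v span_mono[of "set bs" "set (b # bs)"] by auto
      then have "v - smul k b \<in> span (set (b # bs))" using b by (intro span_diff span_scale)
      then have "x = 0" using x Cons.prems(3) by auto
      then have vk: "v = smul k b" using x by simp
      have "k = 0"
      proof (rule ccontr)
        assume "k \<noteq> 0"
        then have "b = smul (inverse k) v" using vk by simp
        then show False using v False span_scale by blast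
      qed
      then show "v \<in> {0}" using vk by simp
    qed
    moreover have "0 \<in> span (set bs) \<inter> ?L" using span_zero subspace_0[OF L] by blast
    ultimately have "span (set bs) \<inter> ?L = {0}" by blast
    from Cons.IH[OF L line(1) this] obtain K where
      K: "K \<ge> 0" "\<And>m c. m \<in> span (set bs) \<Longrightarrow> c \<in> ?L \<Longrightarrow> norm c \<le> K * norm (m + c)" by blast
    obtain K' where K': "K' \<ge> 0" "\<And>x k. x \<in> C \<Longrightarrow> norm x \<le> K' * norm (x + smul k b)"
      using line(2) by blast
    have "norm c \<le> (K' * K) * norm (m + c)" if "m \<in> span (set (b # bs))" "c \<in> C" for m c
    proof -
      have "\<exists>k. m - smul k b \<in> span (set bs)"
        using that(1) span_breakdown_eq[of m b "set bs"] by simp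
      \<comment> \<open>Writing m + c as (m - kb) + (c + kb) moves the part along \<open>b\<close>
        to the side of \<open>?L\<close>, where the induction hypothesis applies; the two bounds
        multiply.\<close>
      then obtain k where k: "m - smul k b \<in> span (set bs)" ..
      have "norm c \<le> K' * norm (c + smul k b)" using K'(2) that(2) .
      also have "\<dots> \<le> K' * (K * norm ((m - smul k b) + (c + smul k b)))"
        using that(2) k K'(1) by (intro mult_left_mono K(2)) auto
      finally show ?thesis by (simp add: mult.assoc)
    qed
    then show ?thesis using K(1) K'(1) by (intro exI[of _ "K' * K"]) auto
  qed
qed

end

section \<open>The algebra of almost complexes\<close>

text \<open>The algebra left over when norms are forgotten. The identity \<delta>\<delta>'\<delta> =
  \<delta> survives only modulo \<open>M\<close>, whereas \<delta>'\<delta>\<delta>' = \<delta>' and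
  \<delta>'\<delta>' = 0 hold exactly; that \<delta>\<delta> = 0 modulo \<open>M\<close> is built
  into the definition of \<open>M\<close>.\<close>

locale split_almost_complex = family_space scale
  for scale :: "'a::field \<Rightarrow> 'b::ab_group_add \<Rightarrow> 'b" +
  fixes n :: nat and S M :: "int \<Rightarrow> 'b set" and d d' :: "int \<Rightarrow> 'b \<Rightarrow> 'b"
  assumes S: "subspace (S p)"
    and S_trivial: "p < 0 \<or> p \<ge> int n + 1 \<Longrightarrow> S p = {0}"
    and M_eq: "M p = (d (p + 1) \<circ> d (p + 2)) ` S (p + 2)"
    and d_in: "x \<in> S p \<Longrightarrow> d p x \<in> S (p - 1)"
    and d_add: "x \<in> S p \<Longrightarrow> y \<in> S p \<Longrightarrow> d p (x + y) = d p x + d p y"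
    and d_scale: "x \<in> S p \<Longrightarrow> d p (scale c x) = scale c (d p x)"
    and d'_in: "y \<in> S (p - 1) \<Longrightarrow> d' p y \<in> S p"
    and d'_add: "x \<in> S (p - 1) \<Longrightarrow> y \<in> S (p - 1) \<Longrightarrow> d' p (x + y) = d' p x + d' p y"
    and d'_scale: "x \<in> S (p - 1) \<Longrightarrow> d' p (scale c x) = scale c (d' p x)"
    and d'_M: "y \<in> M (p - 1) \<Longrightarrow> d' p y = 0"
    and d_d'_d: "x \<in> S p \<Longrightarrow> d p (d' p (d p x)) - d p x \<in> M (p - 1)"
    and d'_d_d': "y \<in> S (p - 1) \<Longrightarrow> d' p (d p (d' p y)) = d' p y"
    and d'_d': "y \<in> S (p - 1) \<Longrightarrow> d' (p + 1) (d' p y) = 0"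
begin

sublocale L: linear_space_pair scale scale ..
sublocale P: linear_space_pair pscale pscale ..

definition "N p = {x \<in> S p. d p x = 0}"
definition "R p = d p ` S p"
definition "K p = {x \<in> S p. d p x \<in> M (p - 1) \<and> d' (p + 1) x = 0}"

lemma d_linear: "L.linear_on (S p) (d p)" and d'_linear: "L.linear_on (S (p - 1)) (d' p)"
  using d_add d_scale d'_add d'_scale by (simp_all add: L.linear_on_def)

lemmas d_diff = L.linear_on_diff[OF d_linear S]
lemmas d'_diff = L.linear_on_diff[OF d'_linear S]
lemmas d_0 = L.linear_on_0[OF d_linear S]

lemma d_in': "x \<in> S (p + 1) \<Longrightarrow> d (p + 1) x \<in> S p"
  using d_in[of x "p + 1"] by simp

lemma d'_in': "y \<in> S p \<Longrightarrow> d' (p + 1) y \<in> S (p + 1)"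
  using d'_in[of y "p + 1"] by simp

lemma d_in'': "x \<in> S (p + 2) \<Longrightarrow> d (p + 2) x \<in> S (p + 1)"
  using d_in[of x "p + 2"] by (simp add: add.commute)

lemma M_subset: "M p \<subseteq> S p"
  using d_in'' d_in' by (auto simp: M_eq)

lemma M_eq': "M (p - 1) = (d p \<circ> d (p + 1)) ` S (p + 1)"
  using M_eq[of "p - 1"] by (simp add: add.commute)

lemma d_d_in: "x \<in> S (p + 1) \<Longrightarrow> d p (d (p + 1) x) \<in> M (p - 1)"
  by (simp add: M_eq')

lemma M_obtain:
  assumes "x \<in> M (p - 1)"
  obtains z where "z \<in> S (p + 1)" "x = d p (d (p + 1) z)"
  using assms by (auto simp: M_eq')

lemma R_subset: "R (p + 1) \<subseteq> S p"
  using d_in' by (auto simp: R_def)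

lemma R_subspace: "subspace (R p)"
  unfolding R_def by (rule L.subspace_linear_image[OF d_linear S])

lemma M_subspace: "subspace (M p)"
proof -
  have "M p = d (p + 1) ` R (p + 2)" by (simp add: M_eq R_def image_comp)
  moreover have "L.linear_on (R (p + 2)) (d (p + 1))"
    using R_subset[of "p + 1"] by (intro L.linear_on_subset[OF d_linear]) (simp add: add.commute)
  ultimately show ?thesis using L.subspace_linear_image R_subspace by simp
qed

lemma N_subspace: "subspace (N p)"
  unfolding N_def using L.subspace_linear_vimage[OF d_linear S subspace_single_0] by simp

lemma K_subspace: "subspace (K p)"
proof -
  have "K p = {x \<in> S p. d p x \<in> M (p - 1)} \<inter> {x \<in> S p. d' (p + 1) x \<in> {0}}"
    by (auto simp: K_def)
  moreover have "L.linear_on (S p) (d' (p + 1))" using d'_linear[of "p + 1"] by simp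
  ultimately show ?thesis
    using subspace_inter L.subspace_linear_vimage[OF d_linear S M_subspace]
      L.subspace_linear_vimage[OF _ S subspace_single_0] by simp
qed

lemma d_M: "x \<in> M p \<Longrightarrow> d p x \<in> M (p - 1)"
  using M_obtain[of x "p + 1"] d_d_in[of _ p] d_in'[of _ "p + 1"] by (metis add_diff_cancel_right')

lemma d'_M': "x \<in> M p \<Longrightarrow> d' (p + 1) x = 0"
  using d'_M[of x "p + 1"] by simp

lemma M_subset_K: "M p \<subseteq> K p"
  using M_subset d_M d'_M' by (auto simp: K_def)

text \<open>\<delta>' y equals \<delta>'(\<delta>\<delta>' y), and \<delta>' vanishes on
  \<open>M\<close>.\<close>

lemma d'_eq_0: "y \<in> S (p - 1) \<Longrightarrow> d p (d' p y) \<in> M (p - 1) \<Longrightarrow> d' p y = 0"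
  using d'_d_d' d'_M by metis

text \<open>Modulo \<open>M\<close>, \<delta>x equals \<delta>\<delta>'\<delta>x, which is 0
  here.\<close>

lemma d_in_M: "x \<in> S (p + 1) \<Longrightarrow> d' (p + 1) (d (p + 1) x) = 0 \<Longrightarrow> d (p + 1) x \<in> M p"
  using d_d'_d[of x "p + 1"] d_0[of "p + 1"] subspace_neg[OF M_subspace, of "- d (p + 1) x" p] by simp

text \<open>The space \<open>?G\<close> is both N + R and K + R, where R is the range of
  \<open>d (p + 1)\<close>, so the second isomorphism theorem applies twice. It remains that
  \<open>K\<close> meets R exactly in \<open>M\<close>, which is \<open>d_in_M\<close>.\<close>

lemma reldim_M_K: "reldim (M p) (K p) = reldim (N p \<inter> R (p + 1)) (N p)"
proof -
  let ?G = "{x \<in> S p. d p x \<in> M (p - 1)}"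
  have "reldim (N p \<inter> R (p + 1)) (N p) = reldim (R (p + 1)) ?G"
  proof (rule reldim_inclusion[OF N_subspace R_subspace])
    show "N p \<subseteq> ?G" using subspace_0[OF M_subspace] by (auto simp: N_def)
    show "\<exists>x\<in>N p. y - x \<in> R (p + 1)" if y: "y \<in> ?G" for y
    proof -
      obtain z where z: "z \<in> S (p + 1)" "d p y = d p (d (p + 1) z)"
        using y by (auto elim: M_obtain)
      then have "y - d (p + 1) z \<in> N p"
        using y d_in' subspace_diff[OF S] by (simp add: N_def d_diff)
      then show ?thesis using z by (intro bexI) (auto simp: R_def)
    qed
  qed
  also have "\<dots> = reldim (K p \<inter> R (p + 1)) (K p)"
  proof (rule reldim_inclusion[OF K_subspace R_subspace, symmetric])
    show "K p \<subseteq> ?G" by (auto simp: K_def)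
    show "\<exists>x\<in>K p. y - x \<in> R (p + 1)" if y: "y \<in> ?G" for y
    proof -
      \<comment> \<open>Subtracting \<delta>\<delta>' y removes from \<open>y\<close> its part in
        the range: \<delta>' kills the remainder since \<delta>'\<delta>\<delta>' = \<delta>', and
        \<delta> of it stays in \<open>M\<close> since \<delta>\<delta> maps into
        \<open>M\<close>.\<close>
      let ?z = "d' (p + 1) y"
      have z: "?z \<in> S (p + 1)" using y d'_in' by simp
      have "d p (y - d (p + 1) ?z) \<in> M (p - 1)"
        using y z d_in' d_d_in[OF z] subspace_diff[OF M_subspace] by (simp add: d_diff)
      moreover have "d' (p + 1) (y - d (p + 1) ?z) = 0"
        using y z d_in'[OF z] d'_diff[of y "p + 1" "d (p + 1) ?z"] d'_d_d'[of y "p + 1"] by simp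
      ultimately have "y - d (p + 1) ?z \<in> K p"
        using y z d_in' subspace_diff[OF S] by (simp add: K_def)
      then show ?thesis using z by (intro bexI) (auto simp: R_def)
    qed
  qed
  also have "K p \<inter> R (p + 1) = M p"
  proof
    show "K p \<inter> R (p + 1) \<subseteq> M p" using d_in_M by (auto simp: K_def R_def)
    have "M p \<subseteq> R (p + 1)" using d_in'' by (auto simp: M_eq R_def)
    then show "M p \<subseteq> K p \<inter> R (p + 1)" using M_subset_K by blast
  qed
  finally show ?thesis by simp
qed

text \<open>Restricted to \<open>R (p + 1)\<close>, the map \<open>d p\<close> has kernel
  \<open>N p \<inter> R (p + 1)\<close> and image \<open>M (p - 1)\<close>.\<close>

lemma reldim_R: "reldim (N p \<inter> R (p + 1)) (R (p + 1)) = reldim {0} (M (p - 1))"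
proof (rule L.reldim_iso[of _ "d p"])
  show "L.linear_on (R (p + 1)) (d p)" using L.linear_on_subset[OF d_linear R_subset] .
  show "d p ` R (p + 1) \<subseteq> M (p - 1)" using d_d_in by (auto simp: R_def)
  show "\<exists>x\<in>R (p + 1). y - d p x \<in> {0}" if y: "y \<in> M (p - 1)" for y
    using y by (auto simp: R_def elim!: M_obtain)
  show "N p \<inter> R (p + 1) = {x \<in> R (p + 1). d p x \<in> {0}}" using R_subset by (auto simp: N_def)
qed (simp_all add: R_subspace)

section \<open>Kernel and cokernel of \<delta> + \<delta>' on families\<close>

definition total :: "int set \<Rightarrow> (int \<Rightarrow> 'b) \<Rightarrow> int \<Rightarrow> 'b" where
  "total J x = (\<lambda>q. if q \<in> J then d (q + 1) (x (q + 1)) + d' q (x (q - 1)) else 0)"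

lemma reldim_families_interval:
  assumes "\<And>p. subspace (A p)" "\<And>p. subspace (B p)" "\<And>p. A p \<subseteq> B p" "\<And>p. B p \<subseteq> S p"
  shows "F.reldim (families I A) (families I B) = (\<Sum>p\<in>I \<inter> {0..int n}. reldim (A p) (B p))"
proof (rule reldim_families)
  show "A p = B p" if "p \<in> I - I \<inter> {0..int n}" for p
    using that S_trivial[of p] assms(3,4)[of p] subspace_0[OF assms(1), of p] by auto
qed (use assms in auto)

lemma families_0: "families I (\<lambda>_. {0}) = {0}"
  by (auto simp: families_def fun_eq_iff)

text \<open>\<open>I\<close> and \<open>J\<close> will be the even and the odd integers, in either
  order, so that both operators of the theorem are treated at once.\<close>

context
  fixes I J :: "int set"
  assumes IJ: "\<And>p. p \<in> J \<longleftrightarrow> p + 1 \<in> I" "\<And>p. p \<in> J \<longleftrightarrow> p - 1 \<in> I"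
begin

lemma families_neighbours:
  assumes "x \<in> families I S" "q \<in> J"
  shows "x (q + 1) \<in> S (q + 1)" "x (q - 1) \<in> S (q - 1)"
  using assms IJ by (auto simp: mem_families_iff)

lemma total_linear: "P.linear_on (families I S) (total J)"
  unfolding P.linear_on_def
proof (intro conjI ballI allI)
  show "total J (x + y) = total J x + total J y" if "x \<in> families I S" "y \<in> families I S" for x y
    using families_neighbours that by (auto simp: fun_eq_iff total_def d_add d'_add)
  show "total J (pscale c x) = pscale c (total J x)" if "x \<in> families I S" for x c
    using families_neighbours that
    by (auto simp: fun_eq_iff total_def d_scale d'_scale scale_right_distrib)
qed

lemma total_in: "total J ` families I S \<subseteq> families J S"
  using families_neighbours d_in' d'_in subspace_add[OF S]
  by (auto simp: mem_families_iff total_def)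

text \<open>An instance of \<open>snake_dimensions\<close> with the families in \<open>M\<close> as
  the distinguished subspaces. The preimage of those over \<open>J\<close> consists of the families
  in \<open>K\<close> over \<open>I\<close>, and the cokernel modulo them is K/M over
  \<open>J\<close>. The splitting \<open>r\<close>, \<open>q\<close> avoids subtracting in
  \<open>enat\<close>.\<close>

lemma total_dimensions:
  obtains r q where
    "F.reldim {0} {x \<in> families I S. total J x = 0} + r =
      (\<Sum>p\<in>I \<inter> {0..int n}. reldim {0} (M p)) + (\<Sum>p\<in>I \<inter> {0..int n}. reldim (N p \<inter> R (p + 1)) (N p))"
    "(\<Sum>p\<in>J \<inter> {0..int n}. reldim {0} (M p)) = r + q"
    "F.reldim (total J ` families I S) (families J S) =
      q + (\<Sum>p\<in>J \<inter> {0..int n}. reldim (N p \<inter> R (p + 1)) (N p))"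
proof -
  let ?T = "total J"
  note IS = families_neighbours and T_lin = total_linear and T_S = total_in
  have T_J: "?T x q = d (q + 1) (x (q + 1)) + d' q (x (q - 1))" if "q \<in> J" for x q
    using that by (simp add: total_def)
  have IM: "x (q + 1) \<in> M (q + 1)" "x (q - 1) \<in> M (q - 1)" if "x \<in> families I M" "q \<in> J" for x q
    using that IJ by (auto simp: mem_families_iff)
  have T_M: "?T ` families I M \<subseteq> families J M"
    using IM d_M d'_M by (fastforce simp: mem_families_iff total_def)
  \<comment> \<open>Applying \<delta> turns the \<delta>-part of the value into an element of
    \<open>M\<close>, so \<delta>\<delta>' x lies in \<open>M\<close> too and \<open>d'_eq_0\<close>
    applies. This separates the two summands of the operator.\<close>
  have T_in_M_d': "d' q (x (q - 1)) = 0"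
    if "x \<in> families I S" "q \<in> J" "d q (?T x q) \<in> M (q - 1)" for x q
  proof -
    have s: "x (q + 1) \<in> S (q + 1)" "x (q - 1) \<in> S (q - 1)" using IS that by auto
    then have "d q (?T x q) = d q (d (q + 1) (x (q + 1))) + d q (d' q (x (q - 1)))"
      using that(2) d_in' d'_in by (simp add: T_J d_add)
    then have "d q (d' q (x (q - 1))) = d q (?T x q) - d q (d (q + 1) (x (q + 1)))" by simp
    then have "d q (d' q (x (q - 1))) \<in> M (q - 1)"
      using that(3) d_d_in[OF s(1)] subspace_diff[OF M_subspace] by simp
    then show ?thesis using d'_eq_0 s by simp
  qed
  \<comment> \<open>The component at \<open>p + 1\<close> yields the condition of \<open>K p\<close>
    on \<delta>', the component at \<open>p - 1\<close> the one on \<delta>.\<close>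
  have vimage: "{x \<in> families I S. ?T x \<in> families J M} = families I K"
  proof (intro set_eqI iffI)
    fix x assume "x \<in> {x \<in> families I S. ?T x \<in> families J M}"
    then have x: "x \<in> families I S" "?T x \<in> families J M" by auto
    have c: "d' q (x (q - 1)) = 0 \<and> d (q + 1) (x (q + 1)) \<in> M q" if "q \<in> J" for q
    proof -
      have t: "?T x q \<in> M q" using x(2) that by (simp add: mem_families_iff)
      then have "d' q (x (q - 1)) = 0" using T_in_M_d'[OF x(1) that] d_M by simp
      then show ?thesis using t T_J[OF that] by simp
    qed
    have "x p \<in> K p" if "p \<in> I" for p
    proof -
      have "p + 1 \<in> J" "p - 1 \<in> J" using that IJ(1)[of "p - 1"] IJ(2)[of "p + 1"] by simp_all
      then show ?thesis using c[of "p + 1"] c[of "p - 1"] that x(1) by (simp add: K_def mem_families_iff)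
    qed
    then show "x \<in> families I K" using x(1) by (simp add: mem_families_iff)
  next
    fix x assume x: "x \<in> families I K"
    then have "x \<in> families I S" using families_mono[of K S I] by (auto simp: K_def)
    moreover have "?T x q \<in> M q" if "q \<in> J" for q
    proof -
      have "x (q + 1) \<in> K (q + 1)" "x (q - 1) \<in> K (q - 1)"
        using x that IJ by (auto simp: mem_families_iff)
      then show ?thesis using T_J[OF that] by (simp add: K_def)
    qed
    moreover have "?T x q = 0" if "q \<notin> J" for q using that by (simp add: total_def)
    ultimately show "x \<in> {x \<in> families I S. ?T x \<in> families J M}" by (simp add: mem_families_iff)
  qed
  let ?Z = "{t + m | t m. t \<in> ?T ` families I S \<and> m \<in> families J M}"
  have Z: "F.subspace ?Z"
    using F.subspace_sums[OF P.subspace_linear_image[OF T_lin subspace_families[OF S]]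
        subspace_families[OF M_subspace]] .
  \<comment> \<open>If a value of the operator lies in \<open>K\<close>, its \<delta>'-part
    vanishes; the remaining \<delta>-part is killed by \<delta>' and hence lies in \<open>M\<close>
    by \<open>d_in_M\<close>.\<close>
  have "families J K \<inter> ?Z = families J M"
  proof (intro set_eqI iffI)
    fix y assume y: "y \<in> families J K \<inter> ?Z"
    then obtain x m where x: "x \<in> families I S" "m \<in> families J M" "y = ?T x + m" by blast
    have "?T x q \<in> M q" if q: "q \<in> J" for q
    proof -
      have "y q \<in> K q" "m q \<in> K q"
        using y x(2) q M_subset_K by (auto simp: mem_families_iff)
      then have "?T x q \<in> K q" using subspace_diff[OF K_subspace, of "y q" q "m q"] x(3) by simp
      then have k: "d q (?T x q) \<in> M (q - 1)" "d' (q + 1) (?T x q) = 0" by (simp_all add: K_def)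
      have "?T x q = d (q + 1) (x (q + 1))" using T_in_M_d'[OF x(1) q k(1)] T_J[OF q] by simp
      then show ?thesis using k(2) d_in_M[of "x (q + 1)" q] IS[OF x(1) q] by simp
    qed
    moreover have "?T x q = 0" if "q \<notin> J" for q using that by (simp add: total_def)
    ultimately have "?T x \<in> families J M" by (simp add: mem_families_iff)
    then show "y \<in> families J M"
      using x F.subspace_add[OF subspace_families[OF M_subspace]] by simp
  next
    fix y assume y: "y \<in> families J M"
    have "y = ?T 0 + y" using P.linear_on_0[OF T_lin subspace_families[OF S]] by simp
    moreover have "0 \<in> families I S" using F.subspace_0[OF subspace_families[OF S]] .
    ultimately have "y \<in> ?Z" using y by blast
    then show "y \<in> families J K \<inter> ?Z" using y families_mono[of M K J] M_subset_K by blast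
  qed
  moreover have "F.reldim (families J K \<inter> ?Z) (families J K) = F.reldim ?Z (families J S)"
  proof (rule F.reldim_inclusion[OF subspace_families[OF K_subspace] Z])
    show "families J K \<subseteq> families J S" by (rule families_mono) (auto simp: K_def)
    fix y assume y: "y \<in> families J S"
    \<comment> \<open>The approximate preimage of \<open>y\<close> is (\<delta> + \<delta>')y.
      Modulo \<open>M\<close> the square of \<delta> + \<delta>' is \<delta>\<delta>' +
      \<delta>'\<delta>, and removing this part from \<open>y\<close> leaves an element of
      \<open>K\<close>.\<close>
    define x where "x = (\<lambda>p. if p \<in> I then d (p + 1) (y (p + 1)) + d' p (y (p - 1)) else 0)"
    have yS: "y p \<in> S p" for p using y subspace_0[OF S] by (cases "p \<in> J") (auto simp: mem_families_iff)
    have x: "x \<in> families I S"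
      using yS d_in' d'_in subspace_add[OF S] by (simp add: x_def mem_families_iff)
    have "y q - ?T x q \<in> K q" if q: "q \<in> J" for q
    proof -
      let ?a = "d (q + 1) (d' (q + 1) (y q))" and ?b = "d' q (d q (y q))"
        and ?m = "d (q + 1) (d (q + 2) (y (q + 2)))"
      have s: "d (q + 2) (y (q + 2)) \<in> S (q + 1)" "d' (q + 1) (y q) \<in> S (q + 1)"
        "d q (y q) \<in> S (q - 1)" "d' (q - 1) (y (q - 2)) \<in> S (q - 1)"
        using d_in'[of "y (q + 2)" "q + 1"] d'_in'[of "y q" q] d_in[of "y q" q]
          d'_in[of "y (q - 2)" "q - 1"] yS by (simp_all add: add.commute)
      have ab: "?a \<in> S q" "?b \<in> S q" using s d_in' d'_in by auto
      have "x (q + 1) = d (q + 2) (y (q + 2)) + d' (q + 1) (y q)"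
        "x (q - 1) = d q (y q) + d' (q - 1) (y (q - 2))"
        using q IJ(1)[of q] IJ(2)[of q] by (simp_all add: x_def add.commute)
      moreover have "d' q (d' (q - 1) (y (q - 2))) = 0" using d'_d'[of "y (q - 2)" "q - 1"] yS by simp
      ultimately have T: "?T x q = ?m + ?a + ?b" using s by (simp add: T_J[OF q] d_add d'_add)
      have m: "?m \<in> M q" using d_d_in[of "y (q + 2)" "q + 1"] yS by (simp add: add.commute)
      \<comment> \<open>\<delta> of \<open>?a\<close> is in \<open>M\<close> because
        \<delta>\<delta> maps into \<open>M\<close>, and the bracket is in \<open>M\<close> because
        \<delta>\<delta>'\<delta> = \<delta> modulo \<open>M\<close>.\<close>
      have "d q (y q - ?a - ?b) = - d q ?a - (d q ?b - d q (y q))"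
        using yS ab subspace_diff[OF S] by (simp add: d_diff)
      then have "d q (y q - ?a - ?b) \<in> M (q - 1)"
        using d_d_in[OF s(2)] d_d'_d[OF yS] subspace_diff[OF M_subspace] subspace_neg[OF M_subspace]
        by metis
      moreover have "d' (q + 1) (y q - ?a - ?b) = 0"
      proof -
        have "d' (q + 1) (y q - ?a - ?b) = d' (q + 1) (y q) - d' (q + 1) ?a - d' (q + 1) ?b"
          using d'_diff[of _ "q + 1"] yS ab subspace_diff[OF S] by simp
        then show ?thesis using d'_d_d'[of "y q" "q + 1"] d'_d'[OF s(3)] yS by simp
      qed
      ultimately have "y q - ?a - ?b \<in> K q"
        using yS ab subspace_diff[OF S] by (simp add: K_def)
      then have "y q - ?a - ?b - ?m \<in> K q" using m M_subset_K subspace_diff[OF K_subspace] by blast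
      then show ?thesis by (simp add: T algebra_simps)
    qed
    moreover have "y q - ?T x q = 0" if "q \<notin> J" for q
      using that y by (simp add: total_def mem_families_iff)
    ultimately have "y - ?T x \<in> families J K" by (simp add: mem_families_iff)
    moreover have "y - (y - ?T x) \<in> ?Z"
    proof -
      have "0 \<in> families J M" using F.subspace_0[OF subspace_families[OF M_subspace]] .
      then show ?thesis using x by (intro CollectI exI[of _ "?T x"] exI[of _ 0]) simp
    qed
    ultimately show "\<exists>x\<in>families J K. y - x \<in> ?Z" by blast
  qed
  ultimately have coker: "F.reldim ?Z (families J S) = F.reldim (families J M) (families J K)" by simp
  have K_S: "K p \<subseteq> S p" for p by (auto simp: K_def)
  have K: "F.reldim (families A M) (families A K) = (\<Sum>p\<in>A \<inter> {0..int n}. reldim (N p \<inter> R (p + 1)) (N p))" for A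
    using reldim_families_interval[OF M_subspace K_subspace M_subset_K K_S] by (simp add: reldim_M_K)
  have M0: "F.reldim {0} (families A M) = (\<Sum>p\<in>A \<inter> {0..int n}. reldim {0} (M p))" for A
    using reldim_families_interval[of "\<lambda>_. {0}" M A] M_subspace M_subset subspace_0[OF M_subspace]
    by (simp add: families_0)
  obtain r q where rq:
    "F.reldim {0} {x \<in> families I S. ?T x = 0} + r =
      F.reldim {0} (families I M) + F.reldim (families I M) {x \<in> families I S. ?T x \<in> families J M}"
    "F.reldim {0} (families J M) = r + q"
    "F.reldim (?T ` families I S) (families J S) = q + F.reldim ?Z (families J S)"
    by (rule P.snake_dimensions[OF T_lin T_S T_M subspace_families[OF S] subspace_families[OF S]
        subspace_families[OF M_subspace] subspace_families[OF M_subspace]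
        families_mono[OF M_subset] families_mono[OF M_subset]])
  show thesis
    by (rule that[of r q]) (use rq in \<open>simp_all only: vimage coker K M0\<close>)
qed

end

end

section \<open>Extensions of the generalized inverses\<close>

sublocale banach_scaling \<subseteq> family_space smul
  by unfold_locales

locale extended_chain = banach_scaling smul
  for smul :: "'k::{real_normed_field, heine_borel} \<Rightarrow> 'a::banach \<Rightarrow> 'a" +
  fixes n :: nat
    and X :: "int \<Rightarrow> ('k, 'a) nspace"
    and d :: "int \<Rightarrow> 'a \<Rightarrow> 'a"
    and dt' :: "int \<Rightarrow> 'a set \<Rightarrow> 'a set"
    and X0 :: "int \<Rightarrow> 'a set"
    and d' :: "int \<Rightarrow> 'a \<Rightarrow> 'a"
  assumes seq: "banach_sequence smul n X d"
    and fin: "fin_dim (subsp (X (p - 2)) (range_sp (X p) (d (p - 1) \<circ> d p)))"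
    and reg: "regular_op (X p) (X (p - 1)) (d p)"
    and gen_inv: "normalized_gen_inverse (calX X d p) (calX X d (p - 1)) (induced X d p) (dt' p)"
    and dt'_dt': "A \<in> vcarrier (calX X d (p - 1)) \<Longrightarrow> dt' (p + 1) (dt' p A) = vzero (calX X d (p + 1))"
    and compl: "closed_complement smul (X p) (RR X d p) (X0 p)"
    and d'_eq: "d' = extension X d X0 dt'"
begin

abbreviation "S p \<equiv> vcarrier (X p)"
abbreviation "M \<equiv> RR X d"

lemma X_carries: "carries (X p) (S p)"
  and X_norm: "vnorm (X p) = norm"
  and S_subspace: "subspace (S p)"
proof -
  have "banach_in smul (X p)" using seq unfolding banach_sequence_def by blast
  then obtain T where T: "subspace T"
    "X p = \<lparr>vcarrier = T, vzero = 0, vadd = (+), vscale = smul, vnorm = norm\<rparr>"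
    unfolding banach_in_def by blast
  then show "carries (X p) (S p)" "vnorm (X p) = norm" "subspace (S p)"
    by (simp_all add: carries_def)
qed

lemmas X_simps = carriesD(2-4)[OF X_carries] X_norm

lemma S_trivial: "p < 0 \<or> p \<ge> int n + 1 \<Longrightarrow> S p = {0}"
  using seq unfolding banach_sequence_def by blast

lemma d_bdd: "bdd_op (X p) (X (p - 1)) (d p)"
  using seq by (simp add: banach_sequence_def)

lemma d_in: "x \<in> S p \<Longrightarrow> d p x \<in> S (p - 1)"
  and d_add: "x \<in> S p \<Longrightarrow> y \<in> S p \<Longrightarrow> d p (x + y) = d p x + d p y"
  and d_scale: "x \<in> S p \<Longrightarrow> d p (smul c x) = smul c (d p x)"
  using d_bdd[of p] by (auto simp: bdd_op_def X_simps)

interpretation L: linear_space_pair smul smul ..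

lemma d_linear: "L.linear_on (S p) (d p)"
  using d_add d_scale by (simp add: L.linear_on_def)

lemma M_eq: "M p = (d (p + 1) \<circ> d (p + 2)) ` S (p + 2)"
  by (simp add: RR_def range_sp_def)

lemma d_in': "x \<in> S (p + 1) \<Longrightarrow> d (p + 1) x \<in> S p"
  using d_in[of x "p + 1"] by simp

lemma d_in'': "x \<in> S (p + 2) \<Longrightarrow> d (p + 2) x \<in> S (p + 1)"
  using d_in[of x "p + 2"] by (simp add: add.commute)

lemma M_subset: "M p \<subseteq> S p"
  using d_in'' d_in' by (auto simp: M_eq)

lemma M_subspace: "subspace (M p)"
proof -
  have "L.linear_on (S (p + 2)) (d (p + 1) \<circ> d (p + 2))"
    using d_in'' by (auto simp: L.linear_on_def d_add d_scale)
  then show ?thesis unfolding M_eq using L.subspace_linear_image S_subspace by blast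
qed

lemma d_M: "x \<in> M p \<Longrightarrow> d p x \<in> M (p - 1)"
proof -
  assume "x \<in> M p"
  then obtain z where z: "z \<in> S (p + 2)" "x = d (p + 1) (d (p + 2) z)" by (auto simp: M_eq)
  have "d (p + 2) z \<in> S (p + 1)" using z d_in'' by simp
  then show ?thesis using M_eq[of "p - 1"] z(2) by (auto simp: add.commute)
qed

section \<open>The quotient maps and the induced operators\<close>

lemma proj_eq_iff: "proj X d p x = proj X d p y \<longleftrightarrow> x - y \<in> M p"
  unfolding proj_def by (rule vcoset_eq_iff[OF X_carries M_subspace])

lemma calX_carrier: "vcarrier (calX X d p) = proj X d p ` S p"
  unfolding calX_def proj_def by (rule vcarrier_quot[OF X_carries])

lemma calX_add: "vadd (calX X d p) (proj X d p x) (proj X d p y) = proj X d p (x + y)"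
  unfolding calX_def proj_def by (rule vcoset_add[OF X_carries M_subspace])

lemma calX_scale: "vscale (calX X d p) c (proj X d p x) = proj X d p (smul c x)"
  unfolding calX_def proj_def by (rule vcoset_scale[OF X_carries M_subspace])

lemma calX_zero: "vzero (calX X d p) = proj X d p 0"
  unfolding calX_def proj_def by (rule vzero_quot[OF X_carries])

lemma mem_proj_iff: "z \<in> proj X d p x \<longleftrightarrow> z - x \<in> M p"
  unfolding proj_def by (rule mem_vcoset_iff[OF X_carries])

lemma induced_proj:
  assumes x: "x \<in> S p"
  shows "induced X d p (proj X d p x) = proj X d (p - 1) (d p x)"
proof -
  have "proj X d (p - 1) (d p z) = proj X d (p - 1) (d p x)" if "z \<in> proj X d p x" for z
  proof -
    have m: "z - x \<in> M p" using that by (simp add: mem_proj_iff)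
    then have "(z - x) + x \<in> S p" using x M_subset subspace_add[OF S_subspace] by blast
    then have "z \<in> S p" by simp
    then have "d p z - d p x = d p (z - x)"
      using x L.linear_on_diff[OF d_linear S_subspace] by simp
    then show ?thesis using d_M[OF m] by (simp add: proj_eq_iff)
  qed
  moreover have "x \<in> proj X d p x" using subspace_0[OF M_subspace] by (simp add: mem_proj_iff)
  ultimately show ?thesis
    unfolding induced_def by (intro the_elem_image_unique) blast+
qed

lemma X0_subspace: "subspace (X0 p)" and X0_closed: "closed (X0 p)" and X0_subset: "X0 p \<subseteq> S p"
  and X0_Int: "M p \<inter> X0 p = {0}" and X0_sum: "S p = {m + c | m c. m \<in> M p \<and> c \<in> X0 p}"
  using compl[of p] unfolding closed_complement_def by iprover+

lemma proj_inj_on: "inj_on (proj X d p) (X0 p)"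
proof (rule inj_onI)
  fix x y assume "x \<in> X0 p" "y \<in> X0 p" "proj X d p x = proj X d p y"
  then have "x - y \<in> M p \<inter> X0 p" using subspace_diff[OF X0_subspace] by (simp add: proj_eq_iff)
  then show "x = y" using X0_Int by simp
qed

lemma proj_X0: "proj X d p ` X0 p = vcarrier (calX X d p)"
proof
  show "proj X d p ` X0 p \<subseteq> vcarrier (calX X d p)" using X0_subset by (auto simp: calX_carrier)
  show "vcarrier (calX X d p) \<subseteq> proj X d p ` X0 p"
  proof
    fix A assume "A \<in> vcarrier (calX X d p)"
    then obtain x where x: "x \<in> S p" "A = proj X d p x" by (auto simp: calX_carrier)
    from x(1) obtain m c where "x = m + c" "m \<in> M p" "c \<in> X0 p" unfolding X0_sum[of p] by blast
    with x(2) have "A = proj X d p c" "c \<in> X0 p" using proj_eq_iff[of p x c] by simp_all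
    then show "A \<in> proj X d p ` X0 p" by (rule image_eqI)
  qed
qed

lemma dt'_bdd: "bdd_op (calX X d (p - 1)) (calX X d p) (dt' p)"
  using gen_inv[of p] by (simp add: normalized_gen_inverse_def gen_inverse_def)

lemma proj_in: "x \<in> S p \<Longrightarrow> proj X d p x \<in> vcarrier (calX X d p)"
  by (simp add: calX_carrier)

lemma dt'_in: "A \<in> vcarrier (calX X d (p - 1)) \<Longrightarrow> dt' p A \<in> vcarrier (calX X d p)"
  using dt'_bdd[of p] by (auto simp: bdd_op_def)

section \<open>Algebraic identities of the extensions\<close>

text \<open>\<open>proj X d p\<close> is a bijection from \<open>X0 p\<close> to the quotient, so
  the inverse in \<open>extension\<close> is genuine on all the values of \<open>dt' p\<close> that
  occur.\<close>

lemma
  assumes "y \<in> S (p - 1)"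
  shows d'_in_X0: "d' p y \<in> X0 p"
    and proj_d': "proj X d p (d' p y) = dt' p (proj X d (p - 1) y)"
proof -
  have "dt' p (proj X d (p - 1) y) \<in> proj X d p ` X0 p"
    using dt'_in proj_in assms proj_X0 by simp
  then show "d' p y \<in> X0 p" "proj X d p (d' p y) = dt' p (proj X d (p - 1) y)"
    unfolding d'_eq extension_def
    using the_inv_into_into[OF proj_inj_on _ subset_refl] f_the_inv_into_f[OF proj_inj_on] by blast+
qed

lemma d'_in: "y \<in> S (p - 1) \<Longrightarrow> d' p y \<in> S p"
  using d'_in_X0 X0_subset by blast

text \<open>The principle behind all identities for \<open>d'\<close> that hold exactly: check them
  in the quotient and lift them by injectivity on \<open>X0 p\<close>.\<close>

lemma d'_eqI:
  assumes "y \<in> S (p - 1)" "x \<in> X0 p" "dt' p (proj X d (p - 1) y) = proj X d p x"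
  shows "d' p y = x"
  using assms d'_in_X0 proj_d' proj_inj_on[THEN inj_onD] by metis

lemma d'_add:
  assumes "x \<in> S (p - 1)" "y \<in> S (p - 1)"
  shows "d' p (x + y) = d' p x + d' p y"
proof (rule d'_eqI)
  have "dt' p (proj X d (p - 1) (x + y)) = vadd (calX X d p) (dt' p (proj X d (p - 1) x)) (dt' p (proj X d (p - 1) y))"
    using dt'_bdd[of p] assms proj_in unfolding bdd_op_def calX_add[symmetric] by blast
  then show "dt' p (proj X d (p - 1) (x + y)) = proj X d p (d' p x + d' p y)"
    using assms by (simp add: proj_d'[symmetric] calX_add)
qed (use assms subspace_add[OF S_subspace] subspace_add[OF X0_subspace] d'_in_X0 in auto)

lemma d'_scale:
  assumes "x \<in> S (p - 1)"
  shows "d' p (smul c x) = smul c (d' p x)"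
proof (rule d'_eqI)
  have "dt' p (proj X d (p - 1) (smul c x)) = vscale (calX X d p) c (dt' p (proj X d (p - 1) x))"
    using dt'_bdd[of p] assms proj_in unfolding bdd_op_def calX_scale[symmetric] by blast
  then show "dt' p (proj X d (p - 1) (smul c x)) = proj X d p (smul c (d' p x))"
    using assms by (simp add: proj_d'[symmetric] calX_scale)
qed (use assms subspace_scale[OF S_subspace] subspace_scale[OF X0_subspace] d'_in_X0 in auto)

lemma d'_M:
  assumes "y \<in> M (p - 1)"
  shows "d' p y = 0"
proof (rule d'_eqI)
  have 0: "0 \<in> S (p - 1)" using subspace_0[OF S_subspace] .
  have "proj X d (p - 1) y = proj X d (p - 1) 0" using assms by (simp add: proj_eq_iff)
  then have "dt' p (proj X d (p - 1) y) = proj X d p (d' p 0)" using proj_d'[OF 0] by simp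
  also have "d' p 0 = 0" using d'_scale[OF 0, of 0] by simp
  finally show "dt' p (proj X d (p - 1) y) = proj X d p 0" .
qed (use assms M_subset subspace_0[OF X0_subspace] in auto)

lemma d_d'_d:
  assumes x: "x \<in> S p"
  shows "d p (d' p (d p x)) - d p x \<in> M (p - 1)"
proof -
  have "induced X d p (dt' p (induced X d p (proj X d p x))) = induced X d p (proj X d p x)"
    using gen_inv[of p] proj_in[OF x] by (simp add: normalized_gen_inverse_def gen_inverse_def)
  then have "proj X d (p - 1) (d p (d' p (d p x))) = proj X d (p - 1) (d p x)"
    using x d_in d'_in by (simp add: induced_proj proj_d'[symmetric])
  then show ?thesis by (simp add: proj_eq_iff)
qed

text \<open>Here equality is exact, both sides lying in \<open>X0 p\<close>. For
  \<open>d_d'_d\<close> the values of \<open>d p\<close> need not lie in the chosen complement, so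
  only a congruence modulo \<open>M\<close> results.\<close>

lemma d'_d_d':
  assumes y: "y \<in> S (p - 1)"
  shows "d' p (d p (d' p y)) = d' p y"
proof (rule d'_eqI)
  have "dt' p (induced X d p (dt' p (proj X d (p - 1) y))) = dt' p (proj X d (p - 1) y)"
    using gen_inv[of p] proj_in[OF y] by (simp add: normalized_gen_inverse_def)
  then show "dt' p (proj X d (p - 1) (d p (d' p y))) = proj X d p (d' p y)"
    using y d'_in by (simp add: induced_proj proj_d'[symmetric])
qed (use y d'_in d_in d'_in_X0 in auto)

lemma d'_d':
  assumes y: "y \<in> S (p - 1)"
  shows "d' (p + 1) (d' p y) = 0"
proof (rule d'_eqI)
  show "dt' (p + 1) (proj X d (p + 1 - 1) (d' p y)) = proj X d (p + 1) 0"
    using dt'_dt'[OF proj_in[OF y]] y by (simp add: proj_d' calX_zero)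
qed (use y d'_in subspace_0[OF X0_subspace] in auto)

section \<open>Boundedness of the extensions\<close>

lemma reldim_M_finite: "reldim {0} (M p) \<noteq> \<infinity>"
proof -
  have "fin_dim (subsp (X p) (M p))" using fin[of "p + 2"] by (simp add: RR_def algebra_simps)
  then show ?thesis using fin_dim_subsp_iff[OF X_carries M_subspace] by blast
qed

text \<open>The quotient map does not increase norms and \<open>dt' p\<close> is bounded; the
  inverse of the quotient map on \<open>X0 p\<close> is bounded because the projection onto
  \<open>X0 p\<close> along the finite-dimensional \<open>M p\<close> is.\<close>

lemma d'_bounded: "\<exists>K\<ge>0. \<forall>y\<in>S (p - 1). norm (d' p y) \<le> K * norm y"
proof -
  obtain bs where bs: "set bs \<subseteq> M p" "M p \<subseteq> span ({0} \<union> set bs)"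
    using reldim_finite_obtain[OF reldim_M_finite] by metis
  have M_span: "M p = span (set bs)"
    using bs span_minimal[OF bs(1) M_subspace] span_insert_0[of "set bs"] by auto
  have "\<exists>K\<ge>0. \<forall>m\<in>M p. \<forall>c\<in>X0 p. norm c \<le> K * norm (m + c)"
    using norm_le_norm_add_span[OF X0_subspace X0_closed, of bs p] X0_Int[of p] M_span by simp
  then obtain K where K: "K \<ge> 0" "\<And>m c. m \<in> M p \<Longrightarrow> c \<in> X0 p \<Longrightarrow> norm c \<le> K * norm (m + c)"
    by blast
  obtain K' where K': "\<And>A. A \<in> vcarrier (calX X d (p - 1)) \<Longrightarrow>
      vnorm (calX X d p) (dt' p A) \<le> K' * vnorm (calX X d (p - 1)) A"
    using dt'_bdd[of p] unfolding bdd_op_def by blast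
  have calX_norm: "vnorm (calX X d p) A = (INF a\<in>A. norm a)" for p A
    by (simp add: calX_def quot_def X_norm)
  have proj_norm: "0 \<le> vnorm (calX X d p) (proj X d p x)" "vnorm (calX X d p) (proj X d p x) \<le> norm x"
    for p x
  proof -
    have x: "x \<in> proj X d p x" using subspace_0[OF M_subspace] by (simp add: mem_proj_iff)
    show "0 \<le> vnorm (calX X d p) (proj X d p x)"
      unfolding calX_norm using x by (intro cINF_greatest) auto
    show "vnorm (calX X d p) (proj X d p x) \<le> norm x"
      unfolding calX_norm using x by (intro cINF_lower bdd_belowI[of _ 0]) auto
  qed
  \<comment> \<open>Every representative of the coset of \<open>c\<close> has the form m + c with
    \<open>m\<close> in \<open>M p\<close>, so the bound passes to the infimum. The constant
    \<open>K + 1\<close> is positive and can be divided by.\<close>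
  have X0_norm: "norm c \<le> (K + 1) * vnorm (calX X d p) (proj X d p c)" if c: "c \<in> X0 p" for c
  proof -
    have "norm c / (K + 1) \<le> (INF a\<in>proj X d p c. norm a)"
    proof (rule cINF_greatest)
      show "proj X d p c \<noteq> {}" using subspace_0[OF M_subspace] mem_proj_iff[of c p c] by auto
      fix a assume "a \<in> proj X d p c"
      then have "norm c \<le> K * norm ((a - c) + c)" using c by (intro K(2)) (simp_all add: mem_proj_iff)
      also have "\<dots> \<le> (K + 1) * norm a" by (simp add: mult_right_mono)
      finally show "norm c / (K + 1) \<le> norm a" using K(1) by (simp add: field_simps)
    qed
    then show ?thesis using K(1) by (simp add: calX_norm field_simps)
  qed
  \<comment> \<open>The absolute value is taken because the constant in \<open>bdd_op\<close> may be
    negative.\<close>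
  have "norm (d' p y) \<le> (K + 1) * \<bar>K'\<bar> * norm y" if y: "y \<in> S (p - 1)" for y
  proof -
    have "norm (d' p y) \<le> (K + 1) * vnorm (calX X d p) (dt' p (proj X d (p - 1) y))"
      using X0_norm[OF d'_in_X0[OF y]] proj_d'[OF y] by simp
    also have "\<dots> \<le> (K + 1) * (K' * vnorm (calX X d (p - 1)) (proj X d (p - 1) y))"
      using K(1) K'[OF proj_in[OF y]] by (intro mult_left_mono) auto
    also have "\<dots> \<le> (K + 1) * (\<bar>K'\<bar> * norm y)"
      using K(1) proj_norm[of "p - 1" y] by (intro mult_left_mono mult_mono) auto
    finally show ?thesis by (simp add: mult.assoc)
  qed
  then show ?thesis using K(1) by (intro exI[of _ "(K + 1) * \<bar>K'\<bar>"]) auto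
qed

sublocale C: split_almost_complex smul n "\<lambda>p. vcarrier (X p)" "RR X d" d d'
  by unfold_locales
    (use S_subspace S_trivial M_eq d_in d_add d_scale d'_in d'_add d'_scale d'_M d_d'_d d'_d_d' d'_d'
      in auto)

end

section \<open>Fredholm operators and the index\<close>

lemma sum_enat_eq_infinity_iff:
  fixes f :: "'i \<Rightarrow> enat"
  assumes "finite A"
  shows "sum f A = \<infinity> \<longleftrightarrow> (\<exists>a\<in>A. f a = \<infinity>)"
  using assms by (induction A) auto

lemma sum_enat: "(\<Sum>a\<in>A. enat (f a)) = enat (sum f A)"
  by (induction A rule: infinite_finite_induct) (auto simp: zero_enat_def)

text \<open>The sum telescopes. With \<open>f\<close> the dimension of \<open>M\<close>, which
  vanishes at -1 and at \<open>n\<close>, it allows an index shift at the cost of a sign.\<close>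

lemma alternating_sum_shift:
  fixes f :: "int \<Rightarrow> int"
  shows "(\<Sum>p=0..n. (-1) ^ p * (f (int p - 1) + f (int p))) = f (-1) + (-1) ^ n * f (int n)"
  by (induction n) (simp_all add: algebra_simps)

lemma sum_evens_minus_odds:
  fixes f :: "int \<Rightarrow> int"
  shows "sum f (evens \<inter> {0..int n}) - sum f (odds \<inter> {0..int n}) = (\<Sum>p=0..n. (-1) ^ p * f (int p))"
proof (induction n)
  case 0
  have "evens \<inter> {0..int 0} = {0}" "odds \<inter> {0..int 0} = {}" by auto
  then show ?case by simp
next
  case (Suc n)
  have S: "{0..int (Suc n)} = insert (int (Suc n)) {0..int n}" by auto
  show ?case
  proof (cases "even n")
    case True
    then have "evens \<inter> {0..int (Suc n)} = evens \<inter> {0..int n}"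
      "odds \<inter> {0..int (Suc n)} = insert (int (Suc n)) (odds \<inter> {0..int n})"
      unfolding S by auto
    then show ?thesis using Suc True by simp
  next
    case False
    then have "odds \<inter> {0..int (Suc n)} = odds \<inter> {0..int n}"
      "evens \<inter> {0..int (Suc n)} = insert (int (Suc n)) (evens \<inter> {0..int n})"
      unfolding S by auto
    then show ?thesis using Suc False by simp
  qed
qed

context extended_chain
begin

section \<open>Direct sums as spaces of families\<close>

abbreviation "XX I \<equiv> families I (\<lambda>p. vcarrier (X p))"

lemma families_X_trivial: "x \<in> XX I \<Longrightarrow> p \<notin> {0..int n} \<Longrightarrow> x p = 0"
  using S_trivial[of p] by (cases "p \<in> I") (auto simp: mem_families_iff)

text \<open>Finite support is automatic, as the components outside \<open>{0..int n}\<close>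
  vanish.\<close>

lemma direct_sum_carries: "F.carries (direct_sum I X) (XX I)"
proof -
  have "finite {p. x p \<noteq> 0}" if "x \<in> XX I" for x
  proof (rule finite_subset)
    show "{p. x p \<noteq> 0} \<subseteq> {0..int n}"
      using families_X_trivial[OF that] by blast
  qed simp
  then show ?thesis
    by (auto simp: F.carries_def direct_sum_def X_simps mem_families_iff fun_eq_iff)
qed

text \<open>A fixed range of summation replaces the support, which varies with
  \<open>x\<close>.\<close>

lemma direct_sum_norm: "x \<in> XX I \<Longrightarrow> vnorm (direct_sum I X) x = (\<Sum>p=0..int n. norm (x p))"
proof -
  assume x: "x \<in> XX I"
  have "{p. x p \<noteq> 0} \<subseteq> {0..int n}" using families_X_trivial[OF x] by blast
  then have "(\<Sum>p | x p \<noteq> 0. norm (x p)) = (\<Sum>p=0..int n. norm (x p))"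
    by (intro sum.mono_neutral_left) auto
  then show ?thesis by (simp add: direct_sum_def X_simps)
qed

lemma norm_component_le:
  assumes "x \<in> XX I"
  shows "norm (x p) \<le> vnorm (direct_sum I X) x"
proof (cases "p \<in> {0..int n}")
  case True
  then show ?thesis
    unfolding direct_sum_norm[OF assms] by (intro member_le_sum) auto
next
  case False
  then have "x p = 0" using families_X_trivial[OF assms] by simp
  then show ?thesis by (simp add: direct_sum_norm[OF assms] sum_nonneg)
qed

lemma direct_sum_carrier: "vcarrier (direct_sum I X) = XX I"
  and direct_sum_zero: "vzero (direct_sum I X) = 0"
  and direct_sum_add: "vadd (direct_sum I X) = (+)"
  and direct_sum_scale: "vscale (direct_sum I X) = pscale"
  using direct_sum_carries by (simp_all add: F.carries_def)

text \<open>Bounds on the single components suffice: only finitely many components count in the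
  norm, and their constants are added.\<close>

lemma bdd_op_direct_sum:
  assumes A_in: "\<And>x. x \<in> XX I \<Longrightarrow> A x \<in> XX J"
    and A_add: "\<And>x y. x \<in> XX I \<Longrightarrow> y \<in> XX I \<Longrightarrow> A (x + y) = A x + A y"
    and A_scale: "\<And>c x. x \<in> XX I \<Longrightarrow> A (pscale c x) = pscale c (A x)"
    and A_bdd: "\<And>q. \<exists>K. \<forall>x\<in>XX I. norm (A x q) \<le> K * vnorm (direct_sum I X) x"
  shows "bdd_op (direct_sum I X) (direct_sum J X) A"
proof -
  obtain K where K: "\<And>q x. x \<in> XX I \<Longrightarrow> norm (A x q) \<le> K q * vnorm (direct_sum I X) x"
    using A_bdd by metis
  have "vnorm (direct_sum J X) (A x) \<le> (\<Sum>q=0..int n. K q) * vnorm (direct_sum I X) x" if "x \<in> XX I" for x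
    unfolding direct_sum_norm[OF A_in[OF that]] sum_distrib_right using K[OF that] by (rule sum_mono)
  then show ?thesis
    unfolding bdd_op_def direct_sum_carrier direct_sum_add direct_sum_scale
    using A_in A_add A_scale by blast
qed

lemma bdd_component:
  assumes "bdd_op (X p) (X q) a"
  shows "\<exists>K\<ge>0. \<forall>x\<in>XX I. p \<in> I \<longrightarrow> norm (a (x p)) \<le> K * vnorm (direct_sum I X) x"
proof -
  obtain K where K: "\<And>x. x \<in> S p \<Longrightarrow> norm (a x) \<le> K * norm x"
    using assms unfolding bdd_op_def X_norm by blast
  have "norm (a (x p)) \<le> \<bar>K\<bar> * vnorm (direct_sum I X) x" if "x \<in> XX I" "p \<in> I" for x
  proof -
    have "norm (a (x p)) \<le> \<bar>K\<bar> * norm (x p)"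
      using K[of "x p"] that mult_right_mono[OF abs_ge_self[of K] norm_ge_zero[of "x p"]]
      by (fastforce simp: mem_families_iff)
    also have "\<dots> \<le> \<bar>K\<bar> * vnorm (direct_sum I X) x"
      using norm_component_le[OF that(1)] by (intro mult_left_mono) auto
    finally show ?thesis .
  qed
  then show ?thesis by (intro exI[of _ "\<bar>K\<bar>"]) auto
qed

lemma bdd_op_shift:
  assumes "\<And>q. q \<in> J \<Longrightarrow> q + k \<in> I" "\<And>q. bdd_op (X (q + k)) (X q) (a q)"
  shows "bdd_op (direct_sum I X) (direct_sum J X) (\<lambda>x q. if q \<in> J then a q (x (q + k)) else 0)"
proof (rule bdd_op_direct_sum)
  have a: "x \<in> S (q + k) \<Longrightarrow> a q x \<in> S q"
    "x \<in> S (q + k) \<Longrightarrow> y \<in> S (q + k) \<Longrightarrow> a q (x + y) = a q x + a q y"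
    "x \<in> S (q + k) \<Longrightarrow> a q (smul c x) = smul c (a q x)" for x y c q
    using assms(2)[of q] by (auto simp: bdd_op_def X_simps)
  have x: "x (q + k) \<in> S (q + k)" if "x \<in> XX I" "q \<in> J" for x q
    using that assms(1) by (simp add: mem_families_iff)
  show "(\<lambda>q. if q \<in> J then a q (x (q + k)) else 0) \<in> XX J" if "x \<in> XX I" for x
    using a(1) x[OF that] by (simp add: mem_families_iff)
  show "(\<lambda>q. if q \<in> J then a q ((x + y) (q + k)) else 0) =
      (\<lambda>q. if q \<in> J then a q (x (q + k)) else 0) + (\<lambda>q. if q \<in> J then a q (y (q + k)) else 0)"
    if "x \<in> XX I" "y \<in> XX I" for x y
    using a(2) x that by (auto simp: fun_eq_iff)
  show "(\<lambda>q. if q \<in> J then a q (smul c (x (q + k))) else 0) =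
      pscale c (\<lambda>q. if q \<in> J then a q (x (q + k)) else 0)" if "x \<in> XX I" for c x
    using a(3) x that by (auto simp: fun_eq_iff)
  show "\<exists>K. \<forall>x\<in>XX I. norm (if q \<in> J then a q (x (q + k)) else 0) \<le> K * vnorm (direct_sum I X) x" for q
  proof (cases "q \<in> J")
    case True
    then show ?thesis using bdd_component[OF assms(2), of I q] assms(1)[OF True] by auto
  qed (auto intro!: exI[of _ 0])
qed

text \<open>Generalized inverses of the single operators are put together componentwise. Under the
  present hypotheses the regularity of the chain is therefore automatic.\<close>

lemma sum_diff_regular:
  assumes IJ: "\<And>p. p \<in> J \<longleftrightarrow> p + 1 \<in> I" "\<And>p. p \<in> J \<longleftrightarrow> p - 1 \<in> I"
  shows "regular_op (direct_sum I X) (direct_sum J X) (sum_diff J X d)"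
proof -
  have "\<exists>b. gen_inverse (X p) (X (p - 1)) (d p) b" for p
    using reg[of p] by (simp add: regular_op_def)
  then obtain b where b: "\<And>p. gen_inverse (X p) (X (p - 1)) (d p) (b p)" by metis
  \<comment> \<open>Written with \<open>p + -1\<close> to be an instance of
    \<open>bdd_op_shift\<close> for the shift -1.\<close>
  let ?B = "\<lambda>y p. if p \<in> I then b p (y (p + -1)) else 0"
  have B: "bdd_op (direct_sum J X) (direct_sum I X) ?B"
    using IJ(1) b by (intro bdd_op_shift) (auto simp: gen_inverse_def algebra_simps)
  have D: "sum_diff J X d = (\<lambda>x q. if q \<in> J then d (q + 1) (x (q + 1)) else 0)"
    by (simp add: sum_diff_def X_simps fun_eq_iff)
  have "bdd_op (direct_sum I X) (direct_sum J X) (sum_diff J X d)"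
    unfolding D using IJ d_bdd[of "_ + 1"] by (intro bdd_op_shift) auto
  moreover have "sum_diff J X d (?B (sum_diff J X d x)) = sum_diff J X d x" if "x \<in> XX I" for x
  proof
    fix q
    show "sum_diff J X d (?B (sum_diff J X d x)) q = sum_diff J X d x q"
    proof (cases "q \<in> J")
      case True
      then have "q + 1 \<in> I" "x (q + 1) \<in> S (q + 1)" using IJ that by (auto simp: mem_families_iff)
      then show ?thesis using b[of "q + 1"] True by (simp add: D gen_inverse_def)
    qed (simp add: D)
  qed
  ultimately show ?thesis
    using B unfolding regular_op_def gen_inverse_def direct_sum_carrier by blast
qed

section \<open>The quotients of a Fredholm chain\<close>

lemma chain_N_eq: "chain_N X d p = C.N p"
  by (simp add: chain_N_def null_sp_def C.N_def X_simps)

lemma chain_R_eq: "chain_R X d p = C.R p"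
  by (simp add: chain_R_def range_sp_def C.R_def)

lemma N_Int_R_subspace: "subspace (C.N p \<inter> C.R (p + 1))"
  by (intro subspace_inter C.N_subspace C.R_subspace)

abbreviation "h p \<equiv> reldim (C.N p \<inter> C.R (p + 1)) (C.N p)"

lemma N_quot_iff: "fin_dim (N_quot X d p) \<longleftrightarrow> h p \<noteq> \<infinity>"
  unfolding N_quot_def chain_N_eq chain_R_eq
  by (rule fin_dim_quot_iff[OF carries_subsp[OF X_carries] N_Int_R_subspace C.N_subspace]) simp

lemma N_quot_dim: "fin_dim (N_quot X d p) \<Longrightarrow> h p = enat (vdim (N_quot X d p))"
  unfolding N_quot_def chain_N_eq chain_R_eq
  by (rule reldim_quot[OF carries_subsp[OF X_carries] N_Int_R_subspace C.N_subspace]) simp_all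

lemma R_quot_fin_dim: "fin_dim (R_quot X d p)"
  unfolding R_quot_def chain_N_eq chain_R_eq
  using fin_dim_quot_iff[OF carries_subsp[OF X_carries] N_Int_R_subspace C.R_subspace]
    C.reldim_R[of p] reldim_M_finite[of "p - 1"] by simp

text \<open>The index is shifted by one: the quotient at \<open>p\<close> has the dimension of
  \<open>M (p - 1)\<close>, which is finite by hypothesis.\<close>

lemma R_quot_dim: "reldim {0} (M (p - 1)) = enat (vdim (R_quot X d p))"
proof -
  have "reldim (C.N p \<inter> C.R (p + 1)) (C.R (p + 1)) = enat (vdim (R_quot X d p))"
    using R_quot_fin_dim[of p] unfolding R_quot_def chain_N_eq chain_R_eq
    by (intro reldim_quot[OF carries_subsp[OF X_carries] N_Int_R_subspace C.R_subspace]) simp_all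
  then show ?thesis by (simp add: C.reldim_R)
qed

lemma h_finite: "p \<notin> {0..int n} \<Longrightarrow> h p \<noteq> \<infinity>"
proof -
  assume "p \<notin> {0..int n}"
  then have "C.N p \<subseteq> {0}" using S_trivial[of p] by (auto simp: C.N_def)
  then have "h p \<le> enat (length ([] :: 'a list))"
    by (intro reldim_le_length) (auto simp: span_zero)
  then show ?thesis by (cases "h p") simp_all
qed

text \<open>Regularity and the finiteness of the quotients of ranges always hold, so only the
  quotients of the null spaces at the finitely many relevant indices can fail.\<close>

lemma regular_fredholm_chain_iff:
  "regular_fredholm_chain smul n X d \<longleftrightarrow> (\<forall>p\<in>{0..int n}. h p \<noteq> \<infinity>)"
proof -
  have "regular_op (direct_sum evens X) (direct_sum odds X) (sum_diff odds X d)"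
    "regular_op (direct_sum odds X) (direct_sum evens X) (sum_diff evens X d)"
    by (rule sum_diff_regular; simp)+
  then show ?thesis
    using seq h_finite R_quot_fin_dim
    by (auto simp: regular_fredholm_chain_def fredholm_chain_def N_quot_iff)
qed

lemma sum_total_eq: "sum_total J X d d' = C.total J"
  by (simp add: sum_total_def C.total_def X_simps fun_eq_iff)

lemma d'_bdd: "bdd_op (X (p - 1)) (X p) (d' p)"
  using d'_bounded[of p] d'_in d'_add d'_scale unfolding bdd_op_def by (auto simp: X_simps)

section \<open>Fredholm property and index of \<delta> + \<delta>'\<close>

context
  fixes I J :: "int set"
  assumes IJ: "\<And>p. p \<in> J \<longleftrightarrow> p + 1 \<in> I" "\<And>p. p \<in> J \<longleftrightarrow> p - 1 \<in> I" "\<And>p. p \<in> J \<longleftrightarrow> p \<notin> I"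
begin

lemma total_bdd: "bdd_op (direct_sum I X) (direct_sum J X) (C.total J)"
proof (rule bdd_op_direct_sum)
  show "C.total J x \<in> XX J" if "x \<in> XX I" for x
    using C.total_in[OF IJ(1,2)] that by blast
  show "C.total J (x + y) = C.total J x + C.total J y" if "x \<in> XX I" "y \<in> XX I" for x y
    using C.P.linear_on_add[OF C.total_linear[OF IJ(1,2)] that] .
  show "C.total J (pscale c x) = pscale c (C.total J x)" if "x \<in> XX I" for x c
    using C.P.linear_on_scale[OF C.total_linear[OF IJ(1,2)] that] .
  show "\<exists>K. \<forall>x\<in>XX I. norm (C.total J x q) \<le> K * vnorm (direct_sum I X) x" for q
  proof (cases "q \<in> J")
    case True
    then have q: "q + 1 \<in> I" "q - 1 \<in> I" using IJ by auto
    obtain K where K: "\<And>x. x \<in> XX I \<Longrightarrow> norm (d (q + 1) (x (q + 1))) \<le> K * vnorm (direct_sum I X) x"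
      using bdd_component[OF d_bdd[of "q + 1"], of I] q by blast
    obtain K' where K': "\<And>x. x \<in> XX I \<Longrightarrow> norm (d' q (x (q - 1))) \<le> K' * vnorm (direct_sum I X) x"
      using bdd_component[OF d'_bdd[of q], of I] q by blast
    have "norm (C.total J x q) \<le> (K + K') * vnorm (direct_sum I X) x" if "x \<in> XX I" for x
      using norm_triangle_le[OF add_mono[OF K[OF that] K'[OF that]]] True
      by (simp add: C.total_def algebra_simps)
    then show ?thesis by blast
  qed (auto simp: C.total_def intro!: exI[of _ 0])
qed

lemma total_kernel_subspace: "F.subspace {x \<in> XX I. C.total J x = 0}"
  using C.P.subspace_linear_vimage[OF C.total_linear[OF IJ(1,2)] subspace_families[OF S_subspace]
      F.subspace_single_0] by simp

lemma total_range_subspace: "F.subspace (C.total J ` XX I)"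
  by (rule C.P.subspace_linear_image[OF C.total_linear[OF IJ(1,2)] subspace_families[OF S_subspace]])

lemma total_null: "null_sp (direct_sum I X) (direct_sum J X) (C.total J) = {x \<in> XX I. C.total J x = 0}"
  by (simp add: null_sp_def direct_sum_carrier direct_sum_zero)

lemma total_range: "range_sp (direct_sum I X) (C.total J) = C.total J ` XX I"
  by (simp add: range_sp_def direct_sum_carrier)

text \<open>In \<open>total_dimensions\<close> all contributions of \<open>M\<close> are finite. So
  the kernel is finite-dimensional iff \<open>h\<close> is finite over \<open>I\<close>, and the
  cokernel iff \<open>h\<close> is finite over \<open>J\<close>. In the index \<open>r\<close> and
  \<open>q\<close> enter only through their sum, which is the total dimension of \<open>M\<close>
  over \<open>J\<close>.\<close>

lemma fredholm_total:
  "fredholm_op (direct_sum I X) (direct_sum J X) (sum_total J X d d') \<longleftrightarrow>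
    regular_fredholm_chain smul n X d" (is "?F \<longleftrightarrow> ?C")
  and fredholm_ind_total:
  "regular_fredholm_chain smul n X d \<Longrightarrow>
    fredholm_ind (direct_sum I X) (direct_sum J X) (sum_total J X d d') =
      (\<Sum>p\<in>I \<inter> {0..int n}. int (vdim (N_quot X d p)) + int (vdim (R_quot X d (p + 1)))) -
      (\<Sum>p\<in>J \<inter> {0..int n}. int (vdim (N_quot X d p)) + int (vdim (R_quot X d (p + 1))))"
proof -
  let ?ker = "F.reldim {0} {x \<in> XX I. C.total J x = 0}"
    and ?coker = "F.reldim (C.total J ` XX I) (XX J)"
    and ?m = "\<lambda>p. vdim (R_quot X d (p + 1))" and ?h = "\<lambda>p. vdim (N_quot X d p)"
  have m: "reldim {0} (M p) = enat (?m p)" for p using R_quot_dim[of "p + 1"] by simp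
  obtain r q where rq:
    "?ker + r = enat (\<Sum>p\<in>I \<inter> {0..int n}. ?m p) + (\<Sum>p\<in>I \<inter> {0..int n}. h p)"
    "enat (\<Sum>p\<in>J \<inter> {0..int n}. ?m p) = r + q"
    "?coker = q + (\<Sum>p\<in>J \<inter> {0..int n}. h p)"
    by (rule C.total_dimensions[OF IJ(1,2), unfolded m sum_enat])
  \<comment> \<open>Both numbers are finite because their sum is.\<close>
  obtain r' q' where r'q': "r = enat r'" "q = enat q'" using rq(2) by (cases r; cases q) auto
  note ker_iff = F.fin_dim_subsp_iff[OF direct_sum_carries total_kernel_subspace]
    and coker_iff = F.fin_dim_quot_iff[OF direct_sum_carries total_range_subspace
      subspace_families[OF S_subspace] C.total_in[OF IJ(1,2)]]
  have "?F \<longleftrightarrow> ?ker \<noteq> \<infinity> \<and> ?coker \<noteq> \<infinity>"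
    unfolding sum_total_eq fredholm_op_def total_null total_range ker_iff coker_iff
    using total_bdd by simp
  also have "?ker \<noteq> \<infinity> \<longleftrightarrow> ?ker + r \<noteq> \<infinity>" using r'q' by (cases ?ker) simp_all
  also have "\<dots> \<longleftrightarrow> (\<forall>p\<in>I \<inter> {0..int n}. h p \<noteq> \<infinity>)"
    unfolding rq(1) by (simp add: sum_enat_eq_infinity_iff plus_eq_infty_iff_enat del: not_infinity_eq)
  also have "?coker \<noteq> \<infinity> \<longleftrightarrow> (\<forall>p\<in>J \<inter> {0..int n}. h p \<noteq> \<infinity>)"
    unfolding rq(3) r'q' by (simp add: sum_enat_eq_infinity_iff plus_eq_infty_iff_enat del: not_infinity_eq)
  also have "(\<forall>p\<in>I \<inter> {0..int n}. h p \<noteq> \<infinity>) \<and> (\<forall>p\<in>J \<inter> {0..int n}. h p \<noteq> \<infinity>) \<longleftrightarrow> ?C"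
    unfolding regular_fredholm_chain_iff using IJ(3) by blast
  finally show FC: "?F \<longleftrightarrow> ?C" .
  assume C: ?C
  then have F: ?F using FC by simp
  have "h p = enat (?h p)" for p
    using C by (intro N_quot_dim) (simp add: regular_fredholm_chain_def fredholm_chain_def)
  then have h: "(\<Sum>p\<in>A \<inter> {0..int n}. h p) = enat (\<Sum>p\<in>A \<inter> {0..int n}. ?h p)" for A
    by (simp add: sum_enat)
  let ?k = "vdim (subsp (direct_sum I X) {x \<in> XX I. C.total J x = 0})"
    and ?c = "vdim (quot (direct_sum J X) (C.total J ` XX I))"
  have "?ker = enat ?k"
    using F unfolding fredholm_op_def sum_total_eq total_null
    by (intro F.reldim_subsp[OF direct_sum_carries total_kernel_subspace]) simp
  then have k: "?k + r' = (\<Sum>p\<in>I \<inter> {0..int n}. ?m p) + (\<Sum>p\<in>I \<inter> {0..int n}. ?h p)"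
    using rq(1) unfolding h r'q' by simp
  have "?coker = enat ?c"
    using F unfolding fredholm_op_def sum_total_eq total_range
    by (intro F.reldim_quot[OF direct_sum_carries total_range_subspace
      subspace_families[OF S_subspace] C.total_in[OF IJ(1,2)]]) simp
  then have c: "?c = q' + (\<Sum>p\<in>J \<inter> {0..int n}. ?h p)"
    using rq(3) unfolding h r'q' by simp
  have m: "(\<Sum>p\<in>J \<inter> {0..int n}. ?m p) = r' + q'" using rq(2) unfolding r'q' by simp
  have "int ?k - int ?c = int (\<Sum>p\<in>I \<inter> {0..int n}. ?m p) + int (\<Sum>p\<in>I \<inter> {0..int n}. ?h p) -
      (int (\<Sum>p\<in>J \<inter> {0..int n}. ?m p) + int (\<Sum>p\<in>J \<inter> {0..int n}. ?h p))"
    using k c m by linarith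
  then show "fredholm_ind (direct_sum I X) (direct_sum J X) (sum_total J X d d') =
      (\<Sum>p\<in>I \<inter> {0..int n}. int (?h p) + int (?m p)) - (\<Sum>p\<in>J \<inter> {0..int n}. int (?h p) + int (?m p))"
    unfolding fredholm_ind_def sum_total_eq total_null total_range by (simp add: sum.distrib)
qed

end

text \<open>\<open>chain_ind\<close> counts the dimension of \<open>M (p - 1)\<close> with a minus
  sign, the right-hand side that of \<open>M p\<close> with a plus sign. The difference telescopes
  to boundary terms.\<close>

lemma chain_ind_eq:
  "chain_ind n X d =
    (\<Sum>p\<in>evens \<inter> {0..int n}. int (vdim (N_quot X d p)) + int (vdim (R_quot X d (p + 1)))) -
    (\<Sum>p\<in>odds \<inter> {0..int n}. int (vdim (N_quot X d p)) + int (vdim (R_quot X d (p + 1))))"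
proof -
  let ?h = "\<lambda>p. int (vdim (N_quot X d p))" and ?m = "\<lambda>p. int (vdim (R_quot X d (p + 1)))"
  have m0: "?m p = 0" if "M p \<subseteq> {0}" for p
  proof -
    have "reldim {0} (M p) \<le> enat (length ([] :: 'a list))"
      using that by (intro reldim_le_length) (auto simp: span_zero)
    then show ?thesis using R_quot_dim[of "p + 1"] by simp
  qed
  \<comment> \<open>The boundary terms vanish: \<open>M (-1)\<close> lies in the trivial space at
    -1, and \<open>M (int n)\<close> is an image of the trivial space at n + 2.\<close>
  have "M (-1) \<subseteq> {0}" using M_subset[of "-1"] S_trivial[of "-1"] by simp
  moreover have "M (int n) \<subseteq> {0}"
    using S_trivial[of "int n + 2"] S_trivial[of "int n + 1"] d_in''[of _ "int n"] C.d_0[of "int n + 1"]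
    by (auto simp: M_eq)
  ultimately have "(\<Sum>p=0..n. (-1) ^ p * (?m (int p - 1) + ?m (int p))) = 0"
    unfolding alternating_sum_shift[of ?m] using m0[of "-1"] m0[of "int n"] by simp
  then have "(\<Sum>p=0..n. (-1) ^ p * (?h (int p) + ?m (int p))) =
      (\<Sum>p=0..n. (-1) ^ p * (?h (int p) - ?m (int p - 1)))"
    by (simp add: sum.distrib sum_subtractf algebra_simps)
  then show ?thesis unfolding sum_evens_minus_odds chain_ind_def by simp
qed

text \<open>Exchanging the even and the odd integers reverses the sign of the index formula, which
  accounts for the minus sign of the second operator.\<close>

lemma equivalences_and_index:
  "(regular_fredholm_chain smul n X d \<longleftrightarrow>
      fredholm_op (direct_sum evens X) (direct_sum odds X) (sum_total odds X d d')) \<and>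
   (regular_fredholm_chain smul n X d \<longleftrightarrow>
      fredholm_op (direct_sum odds X) (direct_sum evens X) (sum_total evens X d d')) \<and>
   (regular_fredholm_chain smul n X d \<longrightarrow>
      chain_ind n X d = fredholm_ind (direct_sum evens X) (direct_sum odds X) (sum_total odds X d d') \<and>
      chain_ind n X d = - fredholm_ind (direct_sum odds X) (direct_sum evens X) (sum_total evens X d d'))"
proof -
  have "p \<in> odds \<longleftrightarrow> p + 1 \<in> evens" "p \<in> odds \<longleftrightarrow> p - 1 \<in> evens" "p \<in> odds \<longleftrightarrow> p \<notin> evens"
    "p \<in> evens \<longleftrightarrow> p + 1 \<in> odds" "p \<in> evens \<longleftrightarrow> p - 1 \<in> odds" "p \<in> evens \<longleftrightarrow> p \<notin> odds" for p :: int
    by simp_all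
  note eo = this(1-3) and oe = this(4-6)
  show ?thesis
    using fredholm_total[OF eo] fredholm_total[OF oe] fredholm_ind_total[OF eo] fredholm_ind_total[OF oe]
      chain_ind_eq by simp
qed

end

theorem theorem4p2:
  fixes smul :: "'k::{real_normed_field, heine_borel} \<Rightarrow> 'a::banach \<Rightarrow> 'a"
    and n :: nat
    and X :: "int \<Rightarrow> ('k, 'a) nspace"
    and d :: "int \<Rightarrow> 'a \<Rightarrow> 'a"
    and dt' :: "int \<Rightarrow> 'a set \<Rightarrow> 'a set"
    and X0 :: "int \<Rightarrow> 'a set"
    and d' :: "int \<Rightarrow> 'a \<Rightarrow> 'a"
  assumes "banach_scaling smul"
    and "banach_sequence smul n X d"
    and "\<And>p. fin_dim (subsp (X (p - 2)) (range_sp (X p) (d (p - 1) \<circ> d p)))"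
    and "\<And>p. regular_op (X p) (X (p - 1)) (d p)"
    and "\<And>p. normalized_gen_inverse (calX X d p) (calX X d (p - 1)) (induced X d p) (dt' p)"
    and "\<And>p A. A \<in> vcarrier (calX X d (p - 1)) \<Longrightarrow>
           dt' (p + 1) (dt' p A) = vzero (calX X d (p + 1))"
    and "\<And>p. closed_complement smul (X p) (RR X d p) (X0 p)"
    and "d' = extension X d X0 dt'"
  shows "(regular_fredholm_chain smul n X d \<longleftrightarrow>
            fredholm_op (direct_sum evens X) (direct_sum odds X) (sum_total odds X d d')) \<and>
         (regular_fredholm_chain smul n X d \<longleftrightarrow>
            fredholm_op (direct_sum odds X) (direct_sum evens X) (sum_total evens X d d')) \<and>
         (regular_fredholm_chain smul n X d \<longrightarrow>
            chain_ind n X d = fredholm_ind (direct_sum evens X) (direct_sum odds X) (sum_total odds X d d') \<and>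
            chain_ind n X d = - fredholm_ind (direct_sum odds X) (direct_sum evens X) (sum_total evens X d d'))"
proof -
  interpret extended_chain smul n X d dt' X0 d'
    using assms by (intro extended_chain.intro extended_chain_axioms.intro)
  show ?thesis by (rule equivalences_and_index)
qed

end
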